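(* Suppose Assumptions 1, 2 and 3 (stated in the context) hold, and suppose that for each $i\in\mathcal{N}$ the local objective function $f_i$ is $\mu_i$-strongly convex (for some $\mu_i>0$) with $k_i$-Lipschitz continuous gradient. Consider the differentiated projected algorithm $$\dot{x}_i = \Pi_{\Omega_i}\big(x_i,\,-\nabla f_i(x_i)+\lambda_i\big),$$ $$\dot{\lambda}_i = -\sum_{j\in\mathcal{N}_i}(\lambda_i-\lambda_j)-\sum_{j\in\mathcal{N}_i}(z_i-z_j)+(d_i-x_i),$$ $$\dot{z}_i = \sum_{j\in\mathcal{N}_i}(\lambda_i-\lambda_j),\qquad i\in\mathcal{N},$$ with (bounded) initial points satisfying $x_i(0)\in\Omega_i$ for all $i\in\mathcal{N}$. Then every trajectory of the algorithm converges, as $t\to\infty$, to an equilibrium point of the algorithm. Furthermore, if there are no local feasibility constraints, i.e. $\Omega_i=\mathbf{R}^m$ for all $i=1,\dots,n$, then every trajectory converges exponentially to an equilibrium point: there exist constants $C,\kappa>0$ such that every trajectory $S(t)=(x_i(t),\lambda_i(t),z_i(t))_{i\in\mathcal{N}}$ satisfies $\|S(t)-S^*\|\le C\,\|S(0)-S^*\|\,e^{-\kappa t}$ for all $t\ge0$, where $S^*$ is the equilibrium point to which it converges.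
   Context: Let $\mathcal{N}=\{1,\dots,n\}$ be a set of agents. For each $i\in\mathcal{N}$, $\Omega_i\subset\mathbf{R}^m$ is a closed convex set, $d_i\in\mathbf{R}^m$ is a given vector (local resource), and $f_i:\mathbf{R}^m\to\mathbf{R}$ is a local objective function. The resource allocation problem is to minimize $\sum_{i} f_i(x_i)$ over $x_1,\dots,x_n\in\mathbf{R}^m$ subject to $\sum_i x_i=\sum_i d_i$ and $x_i\in\Omega_i$ for all $i$. A differentiable function $f$ is $\mu$-strongly convex on $\mathbf{R}^m$ ($\mu>0$) if $(x-y)^T(\nabla f(x)-\nabla f(y))\ge\mu\|x-y\|^2$ for all $x,y\in\mathbf{R}^m$. $P_{\Omega}(x)=\arg\min_{y\in\Omega}\|x-y\|$ denotes the Euclidean projection onto a closed convex set $\Omega$. For a closed convex set $\Omega$, $x\in\Omega$ and a direction $v$, the differentiated projection operator is $$\Pi_{\Omega}(x,v)=\lim_{\delta\to 0^+}\frac{P_{\Omega}(x+\delta v)-x}{\delta},$$ which equals the projection of $v$ onto the tangent cone of $\Omega$ at $x$. $\mathcal{G}=(\mathcal{N},\mathcal{E})$ is the communication graph, and $\mathcal{N}_i=\{j : (j,i)\in\mathcal{E}\}$ is the neighbor set of agent $i$. The state variables are $x_i\in\Omega_i$, $\lambda_i,z_i\in\mathbf{R}^m$ for $i\in\mathcal{N}$; the initial values $\lambda_i(0),z_i(0)\in\mathbf{R}^m$ are arbitrary. The right-hand side is discontinuous in general, and trajectories are solutions in the Caratheodory sense: absolutely continuous functions of $t\ge0$ satisfying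 the differential equations for almost all $t$. An equilibrium point is a point $(x_i^*,\lambda_i^*,z_i^* )_{i\in\mathcal{N}}$ with $x_i^*\in\Omega_i$ for all $i$ at which the right-hand sides of all the differential equations vanish. Assumption 1: the functions $f_i$, $i\in\mathcal{N}$, are continuously differentiable convex functions with locally Lipschitz continuous gradients and with positive definite Hessians over $\mathbf{R}^m$. Assumption 2: there exists a finite optimal solution $X^*$ to the resource allocation problem, and Slater's condition holds: there exist $\tilde{x}_i\in \mathrm{int}(\Omega_i)$, $i\in\mathcal{N}$, with $\sum_{i}\tilde{x}_i=\sum_i d_i$. Assumption 3: the graph $\mathcal{G}$ is undirected and connected. *)

theory Defs
  imports "HOL-Analysis.Analysis"
begin

text \<open>
  Vectors of \<open>\<real>\<^sup>m\<close> have type \<open>real ^ 'm\<close>, agents are the elements of the finite (hence nonempty)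
  type \<open>'n\<close>, and the communication graph is given by its set of edges \<open>E\<close>.
\<close>

definition grad :: "('a::euclidean_space \<Rightarrow> real) \<Rightarrow> 'a \<Rightarrow> 'a" where
  "grad f x = (THE D. GDERIV f x :> D)"

definition hessian :: "(real ^ 'm \<Rightarrow> real) \<Rightarrow> real ^ 'm \<Rightarrow> real ^ 'm ^ 'm" where
  "hessian f x = jacobian (grad f) (at x)"

definition pos_definite :: "real ^ 'm ^ 'm \<Rightarrow> bool" where
  "pos_definite A \<longleftrightarrow> transpose A = A \<and> (\<forall>v. v \<noteq> 0 \<longrightarrow> v \<bullet> (A *v v) > 0)"

definition cont_differentiable :: "('a::euclidean_space \<Rightarrow> real) \<Rightarrow> bool" where
  "cont_differentiable f \<longleftrightarrow> (\<forall>x. f differentiable (at x)) \<and> continuous_on UNIV (grad f)"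

definition strongly_convex :: "real \<Rightarrow> ('a::euclidean_space \<Rightarrow> real) \<Rightarrow> bool" where
  "strongly_convex \<mu> f \<longleftrightarrow> \<mu> > 0 \<and> (\<forall>x. f differentiable (at x)) \<and>
     (\<forall>x y. (x - y) \<bullet> (grad f x - grad f y) \<ge> \<mu> * (norm (x - y))\<^sup>2)"

definition feasible :: "('n::finite \<Rightarrow> 'a::euclidean_space set) \<Rightarrow> ('n \<Rightarrow> 'a) \<Rightarrow> ('n \<Rightarrow> 'a) \<Rightarrow> bool" where
  "feasible \<Omega> d x \<longleftrightarrow> (\<Sum>i\<in>UNIV. x i) = (\<Sum>i\<in>UNIV. d i) \<and> (\<forall>i. x i \<in> \<Omega> i)"

definition optimal_solution ::
    "('n::finite \<Rightarrow> 'a::euclidean_space \<Rightarrow> real) \<Rightarrow> ('n \<Rightarrow> 'a set) \<Rightarrow> ('n \<Rightarrow> 'a) \<Rightarrow> ('n \<Rightarrow> 'a) \<Rightarrow> bool" where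
  "optimal_solution f \<Omega> d x \<longleftrightarrow> feasible \<Omega> d x \<and>
     (\<forall>y. feasible \<Omega> d y \<longrightarrow> (\<Sum>i\<in>UNIV. f i (x i)) \<le> (\<Sum>i\<in>UNIV. f i (y i)))"

definition slater :: "('n::finite \<Rightarrow> 'a::euclidean_space set) \<Rightarrow> ('n \<Rightarrow> 'a) \<Rightarrow> bool" where
  "slater \<Omega> d \<longleftrightarrow> (\<exists>x. (\<forall>i. x i \<in> interior (\<Omega> i)) \<and> (\<Sum>i\<in>UNIV. x i) = (\<Sum>i\<in>UNIV. d i))"

definition connected_graph :: "('n \<times> 'n) set \<Rightarrow> bool" where
  "connected_graph E \<longleftrightarrow> (\<forall>i j. (i, j) \<in> E\<^sup>*)"

definition nbrs :: "('n \<times> 'n) set \<Rightarrow> 'n \<Rightarrow> 'n set" where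
  "nbrs E i = {j. (j, i) \<in> E}"

text \<open>
  The differentiated projection operator. It is meaningful for \<open>x \<in> \<Omega>\<close> with \<open>\<Omega>\<close> closed and
  convex, where the limit exists; it is only used there.
\<close>

definition diff_proj :: "'a::euclidean_space set \<Rightarrow> 'a \<Rightarrow> 'a \<Rightarrow> 'a" where
  "diff_proj \<Omega> x v = Lim (at_right 0) (\<lambda>\<delta>::real. (closest_point \<Omega> (x + \<delta> *\<^sub>R v) - x) /\<^sub>R \<delta>)"

text \<open>
  A state is a triple \<open>(x, \<lambda>, z)\<close> of families of vectors indexed by the agents. The norm of this
  type is the Euclidean norm of the stacked vector.
\<close>

type_synonym ('m, 'n) state = "((real ^ 'm) ^ 'n) \<times> ((real ^ 'm) ^ 'n) \<times> ((real ^ 'm) ^ 'n)"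

definition rhs :: "('n::finite \<Rightarrow> real ^ 'm \<Rightarrow> real) \<Rightarrow> ('n \<Rightarrow> (real ^ 'm) set) \<Rightarrow> ('n \<Rightarrow> real ^ 'm)
    \<Rightarrow> ('n \<times> 'n) set \<Rightarrow> ('m, 'n) state \<Rightarrow> ('m, 'n) state" where
  "rhs f \<Omega> d E = (\<lambda>(x, l, z).
     ((\<chi> i. diff_proj (\<Omega> i) (x $ i) (- grad (f i) (x $ i) + l $ i)),
      (\<chi> i. - (\<Sum>j\<in>nbrs E i. l $ i - l $ j) - (\<Sum>j\<in>nbrs E i. z $ i - z $ j) + (d i - x $ i)),
      (\<chi> i. \<Sum>j\<in>nbrs E i. l $ i - l $ j)))"

definition equilibrium :: "('n::finite \<Rightarrow> real ^ 'm \<Rightarrow> real) \<Rightarrow> ('n \<Rightarrow> (real ^ 'm) set) \<Rightarrow> ('n \<Rightarrow> real ^ 'm)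
    \<Rightarrow> ('n \<times> 'n) set \<Rightarrow> ('m, 'n) state \<Rightarrow> bool" where
  "equilibrium f \<Omega> d E S \<longleftrightarrow> (\<forall>i. fst S $ i \<in> \<Omega> i) \<and> rhs f \<Omega> d E S = 0"

definition abs_continuous_on :: "real \<Rightarrow> real \<Rightarrow> (real \<Rightarrow> 'a::real_normed_vector) \<Rightarrow> bool" where
  "abs_continuous_on a b F \<longleftrightarrow> (\<forall>\<epsilon>>0. \<exists>\<delta>>0. \<forall>D. finite D \<longrightarrow>
     (\<forall>(u, v)\<in>D. a \<le> u \<and> u \<le> v \<and> v \<le> b) \<longrightarrow>
     pairwise (\<lambda>(u, v) (u', v'). {u<..<v} \<inter> {u'<..<v'} = {}) D \<longrightarrow>
     (\<Sum>(u, v)\<in>D. v - u) < \<delta> \<longrightarrow> (\<Sum>(u, v)\<in>D. norm (F v - F u)) < \<epsilon>)"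

text \<open>
  Caratheodory solutions on \<open>[0, \<infinity>)\<close>. Absolute continuity on the half line is understood on
  every bounded interval, as usual for solutions of differential equations. The constraint
  \<open>x\<^sub>i(t) \<in> \<Omega>\<^sub>i\<close> is part of the state space; at \<open>t = 0\<close> it is the condition on the initial point.
\<close>

definition trajectory :: "('n::finite \<Rightarrow> real ^ 'm \<Rightarrow> real) \<Rightarrow> ('n \<Rightarrow> (real ^ 'm) set) \<Rightarrow> ('n \<Rightarrow> real ^ 'm)
    \<Rightarrow> ('n \<times> 'n) set \<Rightarrow> (real \<Rightarrow> ('m, 'n) state) \<Rightarrow> bool" where
  "trajectory f \<Omega> d E S \<longleftrightarrow>
     (\<forall>T\<ge>0. abs_continuous_on 0 T S) \<and>
     (\<forall>t\<ge>0. \<forall>i. fst (S t) $ i \<in> \<Omega> i) \<and>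
     (AE t in lebesgue. t \<ge> 0 \<longrightarrow>
        (S has_vector_derivative rhs f \<Omega> d E (S t)) (at t within {0..}))"

end

theory Submission
  imports Defs
begin

text \<open>
  Stack the agents' vectors into \<open>x\<close>, \<open>l\<close>, \<open>z\<close>, let \<open>G\<close> be the stacked gradient map, \<open>L\<close> the graph
  Laplacian and \<open>K\<close> the product of the sets \<open>\<Omega> i\<close>. The algorithm becomes a projected saddle flow
  \<open>x' = \<Pi>\<^sub>K(x, l - G x)\<close>, \<open>l' = - L l - L z + (d - x)\<close>, \<open>z' = L l\<close>. The analysis uses two
  facts about the projection: \<open>(l - G x - x') \<bullet> (y - x) \<le> 0\<close> for every \<open>y \<in> K\<close>, and \<open>norm x' \<le> norm (l - G x)\<close>.

  For an equilibrium \<open>(x\<^sub>0, l\<^sub>0, z\<^sub>0)\<close> the squared distance to it is a Lyapunov function: the skew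
  couplings cancel and half of it decreases at rate at least
  \<open>\<mu> (norm (x - x\<^sub>0))\<^sup>2 + l \<bullet> L l\<close> (\<open>dissipation\<close>). So trajectories are bounded and Lipschitz, and
  Barbalat's lemma gives \<open>x \<longlongrightarrow> x\<^sub>0\<close> and \<open>L l \<longlongrightarrow> 0\<close>. Applying Barbalat once more to \<open>L l\<close>, whose
  limit is now known, gives \<open>L z \<longlongrightarrow> d - x\<^sub>0\<close>; applying a one-sided version to
  \<open>(norm (y - x))\<^sup>2 / 2\<close>, \<open>y \<in> K\<close>, shows that \<open>(l - G x) \<bullet> (y - x)\<close> is asymptotically nonpositive.
  Hence every limit point of a trajectory is an equilibrium, and since the distance to an
  equilibrium never grows, the trajectory converges to that limit point (\<open>flow_converges\<close>).

  Without constraints, adding the small cross terms \<open>\<epsilon> (b \<bullet> L c - a \<bullet> b)\<close> to the energy, where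
  \<open>(a, b, c)\<close> is the deviation from the limit, makes the decay strict in \<open>a\<close>, \<open>b\<close> and \<open>L c\<close>
  (\<open>cross_term_dissipation\<close>). The component of \<open>z\<close> in the kernel of \<open>L\<close> is conserved, so \<open>c\<close> is
  orthogonal to this kernel and \<open>norm (L c)\<close> controls \<open>norm c\<close>
  (\<open>flow_converges_exponentially\<close>).

  An equilibrium exists because Slater's condition yields one multiplier common to all agents at an
  optimal allocation (\<open>optimal_common_multiplier\<close>) and because the Laplacian of a connected graph
  maps onto the families with zero sum (\<open>laplacian_range\<close>).

  The flow is discontinuous and solved only almost everywhere. All estimates therefore rest on one
  comparison principle: an absolutely continuous real function whose derivative is nonpositive
  almost everywhere does not increase (\<open>abs_continuous_on_nonincreasing\<close>).
\<close>

section \<open>Absolutely continuous functions and almost everywhere derivatives\<close>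

text \<open>
  The source of all closure properties below: whatever has increments bounded by those of two
  absolutely continuous functions inherits their moduli.
\<close>

lemma abs_continuous_on_dominated:
  assumes F: "abs_continuous_on a b F" and G: "abs_continuous_on a b G"
    and dom: "\<And>u v. a \<le> u \<Longrightarrow> u \<le> v \<Longrightarrow> v \<le> b \<Longrightarrow>
       norm (H v - H u) \<le> M * (norm (F v - F u) + norm (G v - G u))"
  shows "abs_continuous_on a b H"
  unfolding abs_continuous_on_def
proof (intro allI impI)
  fix \<epsilon> :: real assume "\<epsilon> > 0"
  define e where "e = \<epsilon> / (\<bar>M\<bar> + 1) / 2"
  have e: "e > 0" using \<open>\<epsilon> > 0\<close> by (simp add: e_def)
  obtain dF where dF: "dF > 0" "\<And>D. finite D \<Longrightarrow> (\<forall>(u, v)\<in>D. a \<le> u \<and> u \<le> v \<and> v \<le> b) \<Longrightarrow>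
     pairwise (\<lambda>(u, v) (u', v'). {u<..<v} \<inter> {u'<..<v'} = {}) D \<Longrightarrow>
     (\<Sum>(u, v)\<in>D. v - u) < dF \<Longrightarrow> (\<Sum>(u, v)\<in>D. norm (F v - F u)) < e"
    using F e unfolding abs_continuous_on_def by meson
  obtain dG where dG: "dG > 0" "\<And>D. finite D \<Longrightarrow> (\<forall>(u, v)\<in>D. a \<le> u \<and> u \<le> v \<and> v \<le> b) \<Longrightarrow>
     pairwise (\<lambda>(u, v) (u', v'). {u<..<v} \<inter> {u'<..<v'} = {}) D \<Longrightarrow>
     (\<Sum>(u, v)\<in>D. v - u) < dG \<Longrightarrow> (\<Sum>(u, v)\<in>D. norm (G v - G u)) < e"
    using G e unfolding abs_continuous_on_def by meson
  have "(\<Sum>(u, v)\<in>D. norm (H v - H u)) < \<epsilon>"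
    if D: "finite D" "\<forall>(u, v)\<in>D. a \<le> u \<and> u \<le> v \<and> v \<le> b"
      "pairwise (\<lambda>(u, v) (u', v'). {u<..<v} \<inter> {u'<..<v'} = {}) D"
      "(\<Sum>(u, v)\<in>D. v - u) < min dF dG" for D
  proof -
    have "(\<Sum>(u, v)\<in>D. norm (H v - H u))
        \<le> (\<Sum>(u, v)\<in>D. (\<bar>M\<bar> + 1) * (norm (F v - F u) + norm (G v - G u)))"
    proof (rule sum_mono, clarify)
      fix u v assume "(u, v) \<in> D"
      then have "norm (H v - H u) \<le> M * (norm (F v - F u) + norm (G v - G u))"
        using D(2) by (intro dom) auto
      also have "\<dots> \<le> (\<bar>M\<bar> + 1) * (norm (F v - F u) + norm (G v - G u))"
        by (intro mult_right_mono) auto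
      finally show "norm (H v - H u) \<le> (\<bar>M\<bar> + 1) * (norm (F v - F u) + norm (G v - G u))" .
    qed
    also have "\<dots> = (\<bar>M\<bar> + 1) * ((\<Sum>(u, v)\<in>D. norm (F v - F u)) + (\<Sum>(u, v)\<in>D. norm (G v - G u)))"
      by (simp add: sum_distrib_left[symmetric] sum.distrib[symmetric] case_prod_unfold)
    also have "\<dots> < (\<bar>M\<bar> + 1) * (e + e)"
      using dF(2)[OF D(1-3)] dG(2)[OF D(1-3)] D(4) by (intro mult_strict_left_mono add_strict_mono) auto
    also have "e + e = \<epsilon> / (\<bar>M\<bar> + 1)"
      unfolding e_def by (rule field_sum_of_halves)
    also have "(\<bar>M\<bar> + 1) * (\<epsilon> / (\<bar>M\<bar> + 1)) = \<epsilon>" by simp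
    finally show ?thesis .
  qed
  then show "\<exists>\<delta>>0. \<forall>D. finite D \<longrightarrow> (\<forall>(u, v)\<in>D. a \<le> u \<and> u \<le> v \<and> v \<le> b) \<longrightarrow>
     pairwise (\<lambda>(u, v) (u', v'). {u<..<v} \<inter> {u'<..<v'} = {}) D \<longrightarrow>
     (\<Sum>(u, v)\<in>D. v - u) < \<delta> \<longrightarrow> (\<Sum>(u, v)\<in>D. norm (H v - H u)) < \<epsilon>"
    using dF(1) dG(1) by (intro exI[of _ "min dF dG"]) auto
qed

lemma abs_continuous_on_ident: "abs_continuous_on a b (\<lambda>t. t)"
  unfolding abs_continuous_on_def
proof (intro allI impI exI[of _ "_::real"] conjI)
  fix \<epsilon> :: real and D :: "(real \<times> real) set"
  assume "\<forall>(u, v)\<in>D. a \<le> u \<and> u \<le> v \<and> v \<le> b" "(\<Sum>(u, v)\<in>D. v - u) < \<epsilon>"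
  moreover have "(\<Sum>(u, v)\<in>D. norm (v - u)) = (\<Sum>(u, v)\<in>D. v - u)"
    using calculation(1) by (intro sum.cong) auto
  ultimately show "(\<Sum>(u, v)\<in>D. norm (v - u)) < \<epsilon>" by simp
qed

lemma abs_continuous_on_lipschitz:
  assumes "L-lipschitz_on {a..b} H"
  shows "abs_continuous_on a b H"
proof (rule abs_continuous_on_dominated[OF abs_continuous_on_ident abs_continuous_on_ident])
  fix u v assume "a \<le> u" "u \<le> v" "v \<le> b"
  then have "norm (H v - H u) \<le> L * norm (v - u)"
    using lipschitz_onD[OF assms, of v u] by (auto simp: dist_norm)
  also have "\<dots> \<le> L * (norm (v - u) + norm (v - u))"
    using lipschitz_on_nonneg[OF assms] by (intro mult_left_mono) auto
  finally show "norm (H v - H u) \<le> L * (norm (v - u) + norm (v - u))" .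
qed

lemma abs_continuous_on_const: "abs_continuous_on a b (\<lambda>t. c)"
  by (rule abs_continuous_on_dominated[OF abs_continuous_on_ident abs_continuous_on_ident, of _ _ _ 0]) auto

lemma abs_continuous_on_bounded_linear:
  assumes "bounded_linear h" "abs_continuous_on a b F"
  shows "abs_continuous_on a b (\<lambda>t. h (F t))"
proof -
  interpret bounded_linear h by fact
  obtain K where K: "K > 0" "\<And>x. norm (h x) \<le> norm x * K" using pos_bounded by blast
  show ?thesis
  proof (rule abs_continuous_on_dominated[OF assms(2,2), of _ K])
    fix u v
    have "norm (h (F v) - h (F u)) \<le> K * norm (F v - F u)"
      using K(2) diff by (metis mult.commute)
    also have "\<dots> \<le> K * (norm (F v - F u) + norm (F v - F u))"
      using K(1) by (intro mult_left_mono) auto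
    finally show "norm (h (F v) - h (F u)) \<le> K * (norm (F v - F u) + norm (F v - F u))" .
  qed
qed

lemma abs_continuous_on_add:
  assumes "abs_continuous_on a b F" "abs_continuous_on a b G"
  shows "abs_continuous_on a b (\<lambda>t. F t + G t)"
proof (rule abs_continuous_on_dominated[OF assms, of _ 1])
  fix u v
  show "norm (F v + G v - (F u + G u)) \<le> 1 * (norm (F v - F u) + norm (G v - G u))"
    using norm_triangle_ineq[of "F v - F u" "G v - G u"] by (simp add: algebra_simps)
qed

lemma abs_continuous_on_diff:
  assumes "abs_continuous_on a b F" "abs_continuous_on a b G"
  shows "abs_continuous_on a b (\<lambda>t. F t - G t)"
proof (rule abs_continuous_on_dominated[OF assms, of _ 1])
  fix u v
  show "norm (F v - G v - (F u - G u)) \<le> 1 * (norm (F v - F u) + norm (G v - G u))"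
    using norm_triangle_ineq4[of "F v - F u" "G v - G u"] by (simp add: algebra_simps)
qed

lemma abs_continuous_on_subinterval:
  assumes "abs_continuous_on a b F" "a \<le> c" "e \<le> b"
  shows "abs_continuous_on c e F"
  unfolding abs_continuous_on_def
proof (intro allI impI)
  fix \<epsilon> :: real assume "\<epsilon> > 0"
  then obtain d where d: "d > 0" "\<And>D. finite D \<Longrightarrow> (\<forall>(u, v)\<in>D. a \<le> u \<and> u \<le> v \<and> v \<le> b) \<Longrightarrow>
     pairwise (\<lambda>(u, v) (u', v'). {u<..<v} \<inter> {u'<..<v'} = {}) D \<Longrightarrow>
     (\<Sum>(u, v)\<in>D. v - u) < d \<Longrightarrow> (\<Sum>(u, v)\<in>D. norm (F v - F u)) < \<epsilon>"
    using assms(1) unfolding abs_continuous_on_def by meson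
  show "\<exists>\<delta>>0. \<forall>D. finite D \<longrightarrow> (\<forall>(u, v)\<in>D. c \<le> u \<and> u \<le> v \<and> v \<le> e) \<longrightarrow>
     pairwise (\<lambda>(u, v) (u', v'). {u<..<v} \<inter> {u'<..<v'} = {}) D \<longrightarrow>
     (\<Sum>(u, v)\<in>D. v - u) < \<delta> \<longrightarrow> (\<Sum>(u, v)\<in>D. norm (F v - F u)) < \<epsilon>"
  proof (intro exI[of _ d] conjI allI impI)
    fix D assume "finite D" and D: "\<forall>(u, v)\<in>D. c \<le> u \<and> u \<le> v \<and> v \<le> e"
      and "pairwise (\<lambda>(u, v) (u', v'). {u<..<v} \<inter> {u'<..<v'} = {}) D" "(\<Sum>(u, v)\<in>D. v - u) < d"
    moreover have "\<forall>(u, v)\<in>D. a \<le> u \<and> u \<le> v \<and> v \<le> b" using D assms(2,3) by force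
    ultimately show "(\<Sum>(u, v)\<in>D. norm (F v - F u)) < \<epsilon>" using d(2) by blast
  qed (use d in auto)
qed

lemma abs_continuous_on_imp_continuous_on:
  assumes "abs_continuous_on a b F"
  shows "continuous_on {a..b} F"
  unfolding continuous_on_iff
proof (intro ballI allI impI)
  fix x e :: real assume x: "x \<in> {a..b}" and "e > 0"
  then obtain d where d: "d > 0" "\<And>D. finite D \<Longrightarrow> (\<forall>(u, v)\<in>D. a \<le> u \<and> u \<le> v \<and> v \<le> b) \<Longrightarrow>
     pairwise (\<lambda>(u, v) (u', v'). {u<..<v} \<inter> {u'<..<v'} = {}) D \<Longrightarrow>
     (\<Sum>(u, v)\<in>D. v - u) < d \<Longrightarrow> (\<Sum>(u, v)\<in>D. norm (F v - F u)) < e"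
    using assms unfolding abs_continuous_on_def by meson
  show "\<exists>d>0. \<forall>x'\<in>{a..b}. dist x' x < d \<longrightarrow> dist (F x') (F x) < e"
  proof (intro exI[of _ d] conjI ballI impI)
    fix y assume y: "y \<in> {a..b}" "dist y x < d"
    show "dist (F y) (F x) < e"
      using d(2)[of "{(min x y, max x y)}"] x y
      by (cases "x \<le> y") (auto simp: dist_norm norm_minus_commute)
  qed (use d in auto)
qed

lemma abs_continuous_on_bilinear:
  assumes h: "bounded_bilinear h" and F: "abs_continuous_on a b F" and G: "abs_continuous_on a b G"
  shows "abs_continuous_on a b (\<lambda>t. h (F t) (G t))"
proof -
  interpret bounded_bilinear h by fact
  obtain K where K: "K > 0" "\<And>x y. norm (h x y) \<le> norm x * norm y * K" using pos_bounded by blast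
  have "bounded (F ` {a..b})" "bounded (G ` {a..b})"
    by (intro compact_imp_bounded compact_continuous_image abs_continuous_on_imp_continuous_on F G; simp)+
  then obtain A B where A: "\<And>t. t \<in> {a..b} \<Longrightarrow> norm (F t) \<le> A"
    and B: "\<And>t. t \<in> {a..b} \<Longrightarrow> norm (G t) \<le> B"
    unfolding bounded_iff by blast
  show ?thesis
  proof (rule abs_continuous_on_dominated[OF F G, of _ "K * (\<bar>A\<bar> + \<bar>B\<bar>)"])
    fix u v assume "a \<le> u" "u \<le> v" "v \<le> b"
    then have uv: "norm (G v) \<le> \<bar>A\<bar> + \<bar>B\<bar>" "norm (F u) \<le> \<bar>A\<bar> + \<bar>B\<bar>"
      using B[of v] A[of u] by auto
    have "h (F v) (G v) - h (F u) (G u) = h (F v - F u) (G v) + h (F u) (G v - G u)"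
      by (simp add: diff_left diff_right)
    also have "norm \<dots> \<le> norm (F v - F u) * norm (G v) * K + norm (F u) * norm (G v - G u) * K"
      by (intro norm_triangle_mono K)
    also have "\<dots> \<le> norm (F v - F u) * (\<bar>A\<bar> + \<bar>B\<bar>) * K + (\<bar>A\<bar> + \<bar>B\<bar>) * norm (G v - G u) * K"
      using uv K(1) by (intro add_mono mult_right_mono mult_left_mono) auto
    also have "\<dots> = K * (\<bar>A\<bar> + \<bar>B\<bar>) * (norm (F v - F u) + norm (G v - G u))"
      by (simp add: algebra_simps)
    finally show "norm (h (F v) (G v) - h (F u) (G u))
       \<le> K * (\<bar>A\<bar> + \<bar>B\<bar>) * (norm (F v - F u) + norm (G v - G u))" .
  qed
qed

lemmas abs_continuous_on_inner = abs_continuous_on_bilinear[OF bounded_bilinear_inner]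
lemmas abs_continuous_on_mult = abs_continuous_on_bilinear[OF bounded_bilinear_mult]

text \<open>
  A derivative at the tag controls the increment over any short interval around the tag, not only
  over intervals starting there. This is what a tagged division needs.
\<close>

lemma increment_le_of_nonpos_derivative:
  fixes g :: "real \<Rightarrow> real"
  assumes "(g has_real_derivative D) (at x within S)" "D \<le> 0" "e > 0"
  shows "\<exists>d>0. \<forall>u\<in>S. \<forall>v\<in>S. u \<le> x \<longrightarrow> x \<le> v \<longrightarrow> u \<in> ball x d \<longrightarrow> v \<in> ball x d \<longrightarrow>
     g v - g u \<le> e * (v - u)"
proof -
  obtain d where d: "d > 0" "\<And>y. y \<in> S \<Longrightarrow> \<bar>y - x\<bar> < d \<Longrightarrow> \<bar>g y - g x - D * (y - x)\<bar> \<le> e * \<bar>y - x\<bar>"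
    using assms(1,3) unfolding has_field_derivative_def has_derivative_within_alt
    by (auto simp: mult.commute)
  show ?thesis
  proof (intro exI[of _ d] conjI ballI impI)
    fix u v assume uv: "u \<in> S" "v \<in> S" "u \<le> x" "x \<le> v" "u \<in> ball x d" "v \<in> ball x d"
    have "\<bar>g u - g x - D * (u - x)\<bar> \<le> e * (x - u)" "\<bar>g v - g x - D * (v - x)\<bar> \<le> e * (v - x)"
      using d(2)[of u] d(2)[of v] uv by (auto simp: dist_real_def abs_of_nonpos abs_of_nonneg)
    moreover have "D * (v - u) \<le> 0" using assms(2) uv by (simp add: mult_nonpos_nonneg)
    ultimately show "g v - g u \<le> e * (v - u)" by (simp add: algebra_simps abs_le_iff)
  qed (use d in auto)
qed

text \<open>
  Turns the measure of an open cover of a null set into the length bound that absolute continuity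
  asks for.
\<close>

lemma sum_length_disjoint_intervals:
  fixes D :: "(real \<times> real) set"
  assumes D: "finite D" "\<forall>(u, v)\<in>D. u \<le> v \<and> {u<..<v} \<subseteq> U"
    and disj: "pairwise (\<lambda>(u, v) (u', v'). {u<..<v} \<inter> {u'<..<v'} = {}) D"
    and U: "open U" "emeasure lborel U < ennreal d" and "d > 0"
  shows "(\<Sum>(u, v)\<in>D. v - u) < d"
proof -
  let ?I = "\<lambda>(u, v). {u<..<v::real}"
  have "ennreal (\<Sum>(u, v)\<in>D. v - u) = (\<Sum>p\<in>D. ennreal (snd p - fst p))"
    using D(2) by (subst sum_ennreal[symmetric]) (auto simp: case_prod_unfold)
  also have "\<dots> = (\<Sum>p\<in>D. emeasure lborel (?I p))"
    using D(2) by (intro sum.cong) auto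
  also have "\<dots> = emeasure lborel (\<Union>p\<in>D. ?I p)"
  proof (rule sum_emeasure)
    show "disjoint_family_on ?I D"
      using disj unfolding disjoint_family_on_def pairwise_def by (auto simp: case_prod_unfold)
  qed (use D in auto)
  also have "\<dots> \<le> emeasure lborel U"
    using D(2) U(1) by (intro emeasure_mono) auto
  also have "\<dots> < ennreal d" by fact
  finally show ?thesis using \<open>d > 0\<close>
    by (metis ennreal_less_iff linorder_not_less ennreal_leI)
qed

text \<open>
  The comparison principle. Cover the exceptional null set \<open>N\<close> by an open set \<open>U\<close> of small measure and
  take a tagged division that is fine for a gauge which keeps intervals tagged in \<open>N\<close> inside \<open>U\<close>
  and makes the others short enough for the derivative estimate at the tag. Absolute continuity
  bounds the total increment over the first kind, the sign of the derivative that over the second.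
\<close>

lemma abs_continuous_on_nonincreasing:
  fixes g :: "real \<Rightarrow> real"
  assumes ab: "a \<le> b" and ac: "abs_continuous_on a b g"
    and deriv: "AE t in lebesgue. t \<in> {a..b} \<longrightarrow>
      (\<exists>D\<le>0. (g has_real_derivative D) (at t within {a..b}))"
  shows "g b \<le> g a"
proof (rule field_le_epsilon)
  fix e0 :: real assume "e0 > 0"
  \<comment> \<open>One \<open>e\<close> per unit length for the regular tags and one more for the tags in the null set.\<close>
  define e where "e = e0 / (b - a + 1)"
  have e: "e > 0" using \<open>e0 > 0\<close> ab by (simp add: e_def)
  obtain N where N: "N \<in> null_sets lebesgue"
    and good: "\<And>t. t \<in> {a..b} \<Longrightarrow> t \<notin> N \<Longrightarrow> \<exists>D\<le>0. (g has_real_derivative D) (at t within {a..b})"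
    using deriv unfolding eventually_ae_filter by (auto simp: subset_iff) blast
  obtain d where d: "d > 0" "\<And>D. finite D \<Longrightarrow> (\<forall>(u, v)\<in>D. a \<le> u \<and> u \<le> v \<and> v \<le> b) \<Longrightarrow>
     pairwise (\<lambda>(u, v) (u', v'). {u<..<v} \<inter> {u'<..<v'} = {}) D \<Longrightarrow>
     (\<Sum>(u, v)\<in>D. v - u) < d \<Longrightarrow> (\<Sum>(u, v)\<in>D. norm (g v - g u)) < e"
    using ac e unfolding abs_continuous_on_def by meson
  obtain U where U: "open U" "N \<subseteq> U" "emeasure lborel U < ennreal d"
  proof -
    obtain U where U: "open U" "N \<subseteq> U" "emeasure lebesgue (U - N) < ennreal d"
      using sets_lebesgue_outer_open[of N d] N d(1) by blast
    have "emeasure lebesgue (U - N) = emeasure lebesgue U"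
      using N U(1) by (intro emeasure_Diff_null_set) auto
    then have "emeasure lborel U < ennreal d" using U(1,3) by simp
    then show ?thesis using that U by blast
  qed
  have "\<exists>r>0. t \<in> {a..b} - N \<longrightarrow> (\<forall>u\<in>{a..b}. \<forall>v\<in>{a..b}. u \<le> t \<longrightarrow> t \<le> v \<longrightarrow> u \<in> ball t r \<longrightarrow>
      v \<in> ball t r \<longrightarrow> g v - g u \<le> e * (v - u))" for t
  proof (cases "t \<in> {a..b} - N")
    case True
    then obtain D where "(g has_real_derivative D) (at t within {a..b})" "D \<le> 0"
      using good by blast
    from increment_le_of_nonpos_derivative[OF this e] show ?thesis by auto
  qed (auto intro: exI[of _ 1])
  then obtain r where r: "\<And>t. r t > 0" "\<And>t u v. t \<in> {a..b} - N \<Longrightarrow> u\<in>{a..b} \<Longrightarrow> v\<in>{a..b} \<Longrightarrow> u \<le> t \<Longrightarrow>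
      t \<le> v \<Longrightarrow> u \<in> ball t (r t) \<Longrightarrow> v \<in> ball t (r t) \<Longrightarrow> g v - g u \<le> e * (v - u)"
    by metis
  define \<gamma> where "\<gamma> t = (if t \<in> N then U else ball t (r t))" for t
  have "gauge \<gamma>" using U r(1) by (auto simp: gauge_def \<gamma>_def)
  then obtain p where p: "p tagged_division_of {a..b}" "\<gamma> fine p"
    by (rule fine_division_exists_real)
  have fine: "K \<subseteq> \<gamma> x" if "(x, K) \<in> p" for x K using p(2) that by (rule fineD)
  note pD = tagged_division_ofD[OF p(1)]
  have K: "\<exists>u v. K = {u..v} \<and> u \<le> v \<and> Inf K = u \<and> Sup K = v \<and> a \<le> u \<and> v \<le> b \<and> u \<le> x \<and> x \<le> v"
    if xK: "(x, K) \<in> p" for x K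
  proof -
    from pD(4)[OF xK] obtain u v where uv: "K = {u..v}" by (auto simp: cbox_interval)
    with pD(2,3)[OF xK] have "u \<le> x" "x \<le> v" "{u..v} \<subseteq> {a..b}" by auto
    then show ?thesis using uv by auto
  qed
  define q where "q = {xK \<in> p. fst xK \<in> N}"
  have q: "finite q" "q \<subseteq> p" using pD(1) by (auto simp: q_def)
  let ?h = "\<lambda>(x::real, K::real set). (Inf K, Sup K)"
  have sep: "{Inf K<..<Sup K} \<inter> {Inf K'<..<Sup K'} = {}"
    if "(x, K) \<in> p" "(x', K') \<in> p" "(x, K) \<noteq> (x', K')" for x K x' K'
  proof -
    note disj = pD(5)[OF that]
    obtain u v u' v' where [simp]: "K = {u..v}" "K' = {u'..v'}" and "u \<le> v" "u' \<le> v'"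
      using K[OF \<open>(x, K) \<in> p\<close>] K[OF \<open>(x', K') \<in> p\<close>] by blast
    then show ?thesis using disj by simp
  qed
  have bad: "(\<Sum>(x, K)\<in>q. g (Sup K) - g (Inf K)) < e"
  proof -
    have "(\<Sum>(x, K)\<in>q. g (Sup K) - g (Inf K)) \<le> (\<Sum>(x, K)\<in>q. norm (g (Sup K) - g (Inf K)))"
      by (intro sum_mono) auto
    also have "\<dots> = (\<Sum>(u, v)\<in>?h ` q. norm (g v - g u))"
    \<comment> \<open>Distinct members of the division with the same end points are degenerate and contribute nothing.\<close>
    proof (subst sum.reindex_nontrivial)
      fix X Y assume XY: "X \<in> q" "Y \<in> q" "X \<noteq> Y" "?h X = ?h Y"
      obtain x K' y L where [simp]: "X = (x, K')" "Y = (y, L)" by (cases X, cases Y)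
      have "{Inf K'<..<Sup K'} = {}"
        using sep[of x K' y L] XY q(2) by auto
      moreover have "Inf K' \<le> Sup K'" using K[of x K'] XY q(2) by auto
      ultimately show "(case ?h X of (u, v) \<Rightarrow> norm (g v - g u)) = 0" by auto
    qed (use q in \<open>auto intro!: sum.cong\<close>)
    also have "\<dots> < e"
    proof (rule d(2))
      show "\<forall>(u, v)\<in>?h ` q. a \<le> u \<and> u \<le> v \<and> v \<le> b" using K q(2) by fastforce
      show disj: "pairwise (\<lambda>(u, v) (u', v'). {u<..<v} \<inter> {u'<..<v'} = {}) (?h ` q)"
        unfolding pairwise_def using sep q(2) by (auto simp: subset_iff) blast+
      show "(\<Sum>(u, v)\<in>?h ` q. v - u) < d"
      proof (rule sum_length_disjoint_intervals[OF _ _ disj U(1,3) d(1)])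
        have "Inf K' \<le> Sup K' \<and> {Inf K'<..<Sup K'} \<subseteq> U" if "(x, K') \<in> q" for x K'
        proof -
          have "K' \<subseteq> U" using fine[of x K'] that by (auto simp: \<gamma>_def q_def)
          moreover have "(x, K') \<in> p" using that q(2) by blast
          then obtain u v where "K' = {u..v}" "u \<le> v" using K by blast
          ultimately show ?thesis by auto
        qed
        then show "\<forall>(u, v)\<in>?h ` q. u \<le> v \<and> {u<..<v} \<subseteq> U" by auto
      qed (use q in auto)
    qed (use q in auto)
    finally show ?thesis .
  qed
  have "(\<Sum>(x, K)\<in>p - q. g (Sup K) - g (Inf K)) \<le> (\<Sum>(x, K)\<in>p - q. e * (Sup K - Inf K))"
  proof (rule sum_mono, clarify)
    fix x K' assume xK: "(x, K') \<in> p" "(x, K') \<notin> q"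
    then have "K' \<subseteq> ball x (r x)" "x \<in> {a..b} - N"
      using fine[OF xK(1)] xK pD(2,3)[OF xK(1)] by (auto simp: \<gamma>_def q_def)
    then show "g (Sup K') - g (Inf K') \<le> e * (Sup K' - Inf K')"
      using K[OF xK(1)] by (intro r(2)[of x]) (auto simp: subset_iff)
  qed
  also have "\<dots> \<le> (\<Sum>(x, K)\<in>p. e * (Sup K - Inf K))"
    using pD(1) K e by (intro sum_mono2) fastforce+
  also have "\<dots> = e * (b - a)"
    using additive_tagged_division_1[OF ab p(1), of "\<lambda>x. e * x"] by (simp add: algebra_simps)
  finally have "g b - g a \<le> e * (b - a) + e"
    using bad additive_tagged_division_1[OF ab p(1), of g] sum.subset_diff[OF q(2) pD(1), of "\<lambda>(x, K). g (Sup K) - g (Inf K)"]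
    by linarith
  also have "\<dots> = e * (b - a + 1)" by (simp add: algebra_simps)
  also have "\<dots> = e0" using ab by (simp add: e_def)
  finally show "g b \<le> g a + e0" by simp
qed

text \<open>
  Reduces to the scalar comparison principle by testing \<open>F\<close> against the direction of its own increment.
\<close>

lemma abs_continuous_on_norm_le:
  assumes ab: "a \<le> b" and "B \<ge> 0" and F: "abs_continuous_on a b (F :: real \<Rightarrow> 'a::real_inner)"
    and deriv: "AE t in lebesgue. t \<in> {a..b} \<longrightarrow>
      (\<exists>D. norm D \<le> B \<and> (F has_vector_derivative D) (at t within {a..b}))"
  shows "norm (F b - F a) \<le> B * (b - a)"
proof -
  define w where "w = F b - F a"
  let ?g = "\<lambda>t. w \<bullet> F t - (norm w * B) * t"
  have "?g b \<le> ?g a"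
  proof (rule abs_continuous_on_nonincreasing[OF ab])
    show "abs_continuous_on a b ?g"
      by (intro abs_continuous_on_diff abs_continuous_on_inner abs_continuous_on_mult
          abs_continuous_on_const abs_continuous_on_ident F)
    show "AE t in lebesgue. t \<in> {a..b} \<longrightarrow> (\<exists>D\<le>0. (?g has_real_derivative D) (at t within {a..b}))"
      using deriv
    proof eventually_elim
      case (elim t)
      show ?case
      proof
        assume "t \<in> {a..b}"
        then obtain D where D: "norm D \<le> B" "(F has_vector_derivative D) (at t within {a..b})"
          using elim by blast
        have "((\<lambda>t. w \<bullet> F t) has_vector_derivative w \<bullet> D) (at t within {a..b})"
          by (rule bounded_linear.has_vector_derivative[OF bounded_linear_inner_right D(2)])
        then have "(?g has_real_derivative w \<bullet> D - norm w * B) (at t within {a..b})"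
          unfolding has_real_derivative_iff_has_vector_derivative
          by (auto intro!: derivative_eq_intros)
        moreover have "w \<bullet> D \<le> norm w * B"
          using norm_cauchy_schwarz[of w D] D(1) by (meson mult_left_mono norm_ge_zero order_trans)
        ultimately show "\<exists>D\<le>0. (?g has_real_derivative D) (at t within {a..b})"
          by (intro exI[of _ "w \<bullet> D - norm w * B"]) simp
      qed
    qed
  qed
  then have "w \<bullet> w \<le> norm w * (B * (b - a))" by (simp add: w_def algebra_simps)
  then have *: "norm w * norm w \<le> norm w * (B * (b - a))" by (simp add: dot_square_norm power2_eq_square)
  show ?thesis
  proof (cases "w = 0")
    case True
    have "B * (b - a) \<ge> 0" using ab \<open>B \<ge> 0\<close> by simp
    then show ?thesis using True by (simp add: w_def)
  next
    case False
    then show ?thesis using * by (simp add: w_def)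
  qed
qed

lemma has_real_derivative_inner:
  fixes f g :: "real \<Rightarrow> 'a::real_inner"
  assumes "(f has_vector_derivative f') (at t within A)" "(g has_vector_derivative g') (at t within A)"
  shows "((\<lambda>t. f t \<bullet> g t) has_real_derivative (f t \<bullet> g' + f' \<bullet> g t)) (at t within A)"
  unfolding has_real_derivative_iff_has_vector_derivative
  by (rule bounded_bilinear.has_vector_derivative[OF bounded_bilinear_inner assms])

lemma nonincreasing_halfline:
  fixes g :: "real \<Rightarrow> real"
  assumes ac: "\<And>T. T \<ge> 0 \<Longrightarrow> abs_continuous_on 0 T g"
    and deriv: "AE t in lebesgue. t \<ge> 0 \<longrightarrow> (\<exists>D\<le>0. (g has_real_derivative D) (at t within {0..}))"
    and st: "0 \<le> s" "s \<le> t"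
  shows "g t \<le> g s"
proof (rule abs_continuous_on_nonincreasing[OF st(2)])
  show "abs_continuous_on s t g"
    by (rule abs_continuous_on_subinterval[OF ac[of t]]) (use st in auto)
  show "AE r in lebesgue. r \<in> {s..t} \<longrightarrow> (\<exists>D\<le>0. (g has_real_derivative D) (at r within {s..t}))"
    using deriv
  proof eventually_elim
    case (elim r)
    have "{s..t} \<subseteq> {0..}" using st by auto
    then show ?case using elim DERIV_subset[of g _ r "{0..}" "{s..t}"] st(1)
      by (meson atLeastAtMost_iff order_trans)
  qed
qed

lemma lipschitz_halfline:
  fixes F :: "real \<Rightarrow> 'a::real_inner"
  assumes ac: "\<And>T. T \<ge> 0 \<Longrightarrow> abs_continuous_on 0 T F" and B: "B \<ge> 0"
    and deriv: "AE t in lebesgue. t \<ge> 0 \<longrightarrow>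
      (\<exists>D. norm D \<le> B \<and> (F has_vector_derivative D) (at t within {0..}))"
  shows "B-lipschitz_on {0..} F"
proof -
  have *: "norm (F t - F s) \<le> B * (t - s)" if st: "0 \<le> s" "s \<le> t" for s t
  proof (rule abs_continuous_on_norm_le[OF st(2) B])
    show "abs_continuous_on s t F"
      by (rule abs_continuous_on_subinterval[OF ac[of t]]) (use st in auto)
    show "AE r in lebesgue. r \<in> {s..t} \<longrightarrow>
        (\<exists>D. norm D \<le> B \<and> (F has_vector_derivative D) (at r within {s..t}))"
      using deriv
    proof eventually_elim
      case (elim r)
      have "{s..t} \<subseteq> {0..}" using st by auto
      then show ?case
        using elim has_vector_derivative_within_subset[of F _ r "{0..}" "{s..t}"] st(1)
        by (meson atLeastAtMost_iff order_trans)
    qed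
  qed
  show ?thesis
  proof (rule lipschitz_onI)
    fix s t :: real assume "s \<in> {0..}" "t \<in> {0..}"
    then show "dist (F s) (F t) \<le> B * dist s t"
      using *[of s t] *[of t s] by (cases "s \<le> t") (auto simp: dist_norm norm_minus_commute)
  qed (rule B)
qed

lemma nonincreasing_convergent:
  fixes V :: "real \<Rightarrow> real"
  assumes mono: "\<And>s t. 0 \<le> s \<Longrightarrow> s \<le> t \<Longrightarrow> V t \<le> V s" and "\<And>t. t \<ge> 0 \<Longrightarrow> 0 \<le> V t"
  shows "\<exists>l. (V \<longlongrightarrow> l) at_top"
proof (rule exI, rule order_tendstoI)
  let ?l = "Inf (V ` {0..})"
  have bdd: "bdd_below (V ` {0..})" using assms(2) by (intro bdd_belowI[of _ 0]) auto
  fix a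
  { assume "a < ?l"
    have "a < V t" if "t \<ge> 0" for t
    proof -
      have "?l \<le> V t" using that bdd by (intro cInf_lower) auto
      then show ?thesis using \<open>a < ?l\<close> by simp
    qed
    then show "\<forall>\<^sub>F t in at_top. a < V t" by (rule eventually_mono[OF eventually_ge_at_top[of 0]]) }
  { assume "?l < a"
    then have "\<exists>y\<in>V ` {0..}. y < a" by (subst (asm) cInf_less_iff[OF _ bdd]) auto
    then obtain s where s: "s \<ge> 0" "V s < a" by auto
    show "\<forall>\<^sub>F t in at_top. V t < a"
      using eventually_ge_at_top[of s]
    proof eventually_elim
      case (elim t)
      then show ?case using mono[of s t] s by simp
    qed }
qed

lemma abs_continuous_on_exp: "abs_continuous_on 0 T (\<lambda>t. exp (c * t :: real))"
proof (rule abs_continuous_on_lipschitz[OF bounded_derivative_imp_lipschitz])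
  show "((\<lambda>t. exp (c * t)) has_derivative (\<lambda>h. c * exp (c * t) * h)) (at t within {0..T})" for t
    by (auto intro!: derivative_eq_intros)
  fix t assume t: "t \<in> {0..T}"
  have "c * t \<le> \<bar>c\<bar> * T" using t by (intro mult_mono) auto
  then have "\<bar>c * exp (c * t)\<bar> \<le> \<bar>c\<bar> * exp (\<bar>c\<bar> * T)"
    by (simp add: abs_mult mult_left_mono)
  then show "onorm (\<lambda>h. c * exp (c * t) * h) \<le> \<bar>c\<bar> * exp (\<bar>c\<bar> * T)"
    by (intro onorm_bound) (auto simp: abs_mult intro: mult_right_mono)
qed auto

text \<open>
  Gronwall: \<open>W t * exp (r * t)\<close> does not increase.
\<close>

lemma exponential_decay:
  fixes W :: "real \<Rightarrow> real"
  assumes ac: "\<And>T. T \<ge> 0 \<Longrightarrow> abs_continuous_on 0 T W"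
    and deriv: "AE t in lebesgue. t \<ge> 0 \<longrightarrow>
      (\<exists>D. D \<le> - r * W t \<and> (W has_real_derivative D) (at t within {0..}))"
    and "t \<ge> 0"
  shows "W t \<le> W 0 * exp (- r * t)"
proof -
  let ?g = "\<lambda>t. W t * exp (r * t)"
  have "?g t \<le> ?g 0"
  proof (rule nonincreasing_halfline[of ?g])
    show "abs_continuous_on 0 T ?g" if "T \<ge> 0" for T
      by (intro abs_continuous_on_mult ac that abs_continuous_on_exp)
    show "AE t in lebesgue. t \<ge> 0 \<longrightarrow> (\<exists>D\<le>0. (?g has_real_derivative D) (at t within {0..}))"
      using deriv
    proof eventually_elim
      case (elim t)
      show ?case
      proof
        assume "t \<ge> 0"
        then obtain D where D: "D \<le> - r * W t" "(W has_real_derivative D) (at t within {0..})"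
          using elim by blast
        have "(?g has_real_derivative (D + r * W t) * exp (r * t)) (at t within {0..})"
          by (rule derivative_eq_intros D(2) refl | simp add: algebra_simps)+
        moreover have "(D + r * W t) * exp (r * t) \<le> 0"
          using D(1) by (intro mult_nonpos_nonneg) auto
        ultimately show "\<exists>D\<le>0. (?g has_real_derivative D) (at t within {0..})" by blast
      qed
    qed
  qed (use \<open>t \<ge> 0\<close> in auto)
  then have "?g t * exp (- r * t) \<le> W 0 * exp (- r * t)" by (intro mult_right_mono) auto
  then show ?thesis by (simp add: mult.assoc exp_add[symmetric])
qed

section \<open>Barbalat lemmas for Caratheodory derivatives\<close>

text \<open>
  If \<open>\<phi>\<close> were at least \<open>e\<close> at a late time, uniform continuity would keep it above \<open>e / 2\<close> for a fixed
  duration and \<open>V\<close> would drop by a fixed amount, against its convergence. The rate \<open>\<phi>\<close> may take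
  either sign; this version is what the variational inequality of the projection requires.
\<close>

lemma barbalat_one_sided:
  fixes V \<phi> :: "real \<Rightarrow> real"
  assumes V: "\<And>T. T \<ge> 0 \<Longrightarrow> abs_continuous_on 0 T V" and lim: "(V \<longlongrightarrow> l) at_top"
    and deriv: "AE t in lebesgue. t \<ge> 0 \<longrightarrow>
      (\<exists>D. D \<le> - \<phi> t \<and> (V has_real_derivative D) (at t within {0..}))"
    and uc: "uniformly_continuous_on {0..} \<phi>" and "e > 0"
  shows "eventually (\<lambda>t. \<phi> t < e) at_top"
proof -
  obtain h where h: "h > 0" "\<And>s t. s \<ge> 0 \<Longrightarrow> t \<ge> 0 \<Longrightarrow> \<bar>s - t\<bar> < h \<Longrightarrow> \<bar>\<phi> s - \<phi> t\<bar> < e / 2"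
    using uc \<open>e > 0\<close> unfolding uniformly_continuous_on_def dist_real_def
    by (metis atLeast_iff half_gt_zero)
  define k where "k = h / 2"
  have k: "k > 0" "k < h" using h by (auto simp: k_def)
  have lim': "((\<lambda>t. V (t + k)) \<longlongrightarrow> l) at_top"
    by (rule filterlim_compose[OF lim]) (rule filterlim_tendsto_add_at_top[OF _ filterlim_ident, of "\<lambda>_. k" k, simplified add.commute]; simp)
  have "((\<lambda>t. V t - V (t + k)) \<longlongrightarrow> l - l) at_top" by (intro tendsto_diff lim lim')
  then have "eventually (\<lambda>t. V t - V (t + k) < e / 2 * k) at_top"
    using \<open>e > 0\<close> k by (intro order_tendstoD(2)) auto
  then show ?thesis using eventually_ge_at_top[of 0]
  proof eventually_elim
    case (elim t)
    show ?case
    proof (rule ccontr)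
      assume contr: "\<not> \<phi> t < e"
      let ?g = "\<lambda>s. V s + e / 2 * s"
      have "?g (t + k) \<le> ?g t"
      proof (rule abs_continuous_on_nonincreasing[of t "t + k" ?g])
        show "abs_continuous_on t (t + k) ?g"
          by (rule abs_continuous_on_subinterval[of 0 "t + k"],
              intro abs_continuous_on_add abs_continuous_on_mult abs_continuous_on_const
                abs_continuous_on_ident V) (use elim k in auto)
        show "AE s in lebesgue. s \<in> {t..t + k} \<longrightarrow>
            (\<exists>D\<le>0. (?g has_real_derivative D) (at s within {t..t + k}))"
          using deriv
        proof eventually_elim
          case (elim s)
          show ?case
          proof
            assume s: "s \<in> {t..t + k}"
            with \<open>t \<ge> 0\<close> elim obtain D where D: "D \<le> - \<phi> s" "(V has_real_derivative D) (at s within {0..})"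
              by auto
            have "(V has_real_derivative D) (at s within {t..t + k})"
              by (rule DERIV_subset[OF D(2)]) (use \<open>t \<ge> 0\<close> in auto)
            then have "(?g has_real_derivative D + e / 2) (at s within {t..t + k})"
              by (auto intro!: derivative_eq_intros)
            moreover have "\<bar>\<phi> s - \<phi> t\<bar> < e / 2" using h(2)[of s t] s k \<open>t \<ge> 0\<close> by auto
            then have "D + e / 2 \<le> 0" using D(1) contr by linarith
            ultimately show "\<exists>D\<le>0. (?g has_real_derivative D) (at s within {t..t + k})" by blast
          qed
        qed
      qed (use k in auto)
      then show False using elim by (simp add: algebra_simps add_divide_distrib)
    qed
  qed
qed

text \<open>
  The classical form follows from the one-sided form applied to both signs of each coordinate.
\<close>

lemma barbalat:
  fixes u :: "real \<Rightarrow> 'a::euclidean_space"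
  assumes u: "\<And>T. T \<ge> 0 \<Longrightarrow> abs_continuous_on 0 T u" and lim: "(u \<longlongrightarrow> l) at_top"
    and deriv: "AE t in lebesgue. t \<ge> 0 \<longrightarrow> (u has_vector_derivative w t) (at t within {0..})"
    and uc: "uniformly_continuous_on {0..} w"
  shows "(w \<longlongrightarrow> 0) at_top"
proof -
  have up: "eventually (\<lambda>t. - (c \<bullet> w t) < e) at_top" if "e > 0" for c e
  proof (rule barbalat_one_sided[where V = "\<lambda>t. c \<bullet> u t" and l = "c \<bullet> l"])
    show "abs_continuous_on 0 T (\<lambda>t. c \<bullet> u t)" if "T \<ge> 0" for T
      by (intro abs_continuous_on_inner abs_continuous_on_const u that)
    show "((\<lambda>t. c \<bullet> u t) \<longlongrightarrow> c \<bullet> l) at_top" by (intro tendsto_intros lim)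
    show "AE t in lebesgue. t \<ge> 0 \<longrightarrow>
      (\<exists>D. D \<le> - (- (c \<bullet> w t)) \<and> ((\<lambda>t. c \<bullet> u t) has_real_derivative D) (at t within {0..}))"
      using deriv
    proof eventually_elim
      case (elim t)
      then show ?case
        using bounded_linear.has_vector_derivative[OF bounded_linear_inner_right, of u "w t" "at t within {0..}" c]
        by (auto simp: has_real_derivative_iff_has_vector_derivative)
    qed
    have "uniformly_continuous_on {0..} (\<lambda>t. c \<bullet> w t)"
      by (rule bounded_linear.uniformly_continuous_on[OF bounded_linear_inner_right uc])
    then show "uniformly_continuous_on {0..} (\<lambda>t. - (c \<bullet> w t))"
      by (rule uniformly_continuous_on_minus)
  qed fact
  have "((\<lambda>t. w t \<bullet> c) \<longlongrightarrow> 0) at_top" for c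
  proof (rule order_tendstoI)
    fix e :: real
    show "\<forall>\<^sub>F t in at_top. e < w t \<bullet> c" if "e < 0"
      using up[of "- e" c] that by (simp add: inner_commute)
    show "\<forall>\<^sub>F t in at_top. w t \<bullet> c < e" if "0 < e"
      using up[of e "- c"] that by (simp add: inner_commute)
  qed
  then have "((\<lambda>t. \<Sum>c\<in>Basis. (w t \<bullet> c) *\<^sub>R c) \<longlongrightarrow> (\<Sum>c\<in>Basis. 0 *\<^sub>R c)) at_top"
    by (intro tendsto_sum tendsto_scaleR tendsto_const)
  then show ?thesis by (simp add: euclidean_representation)
qed

section \<open>The differentiated projection\<close>

text \<open>
  The difference quotient \<open>q\<close> is the projection of \<open>v\<close> onto the set of all \<open>(y - x) / \<delta>\<close>, \<open>y \<in> \<Omega>\<close>.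
\<close>

lemma difference_quotient_variational:
  fixes \<Omega> :: "'a::euclidean_space set" and x v :: 'a
  assumes \<Omega>: "closed \<Omega>" "convex \<Omega>" "x \<in> \<Omega>" and "\<delta> > 0" "y \<in> \<Omega>"
  defines "q \<equiv> (closest_point \<Omega> (x + \<delta> *\<^sub>R v) - x) /\<^sub>R \<delta>"
  shows "(v - q) \<bullet> ((y - x) /\<^sub>R \<delta> - q) \<le> 0"
proof -
  let ?c = "closest_point \<Omega> (x + \<delta> *\<^sub>R v)"
  have "(x + \<delta> *\<^sub>R v - ?c) \<bullet> (y - ?c) \<le> 0"
    using \<Omega> \<open>y \<in> \<Omega>\<close> by (intro closest_point_dot) auto
  moreover have q: "\<delta> *\<^sub>R q = ?c - x" using \<open>\<delta> > 0\<close> by (simp add: q_def)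
  have "x + \<delta> *\<^sub>R v - ?c = \<delta> *\<^sub>R (v - q)" by (simp add: scaleR_diff_right q)
  moreover have "y - ?c = \<delta> *\<^sub>R ((y - x) /\<^sub>R \<delta> - q)"
    using \<open>\<delta> > 0\<close> by (simp add: scaleR_diff_right q)
  ultimately have "\<delta> * (\<delta> * ((v - q) \<bullet> ((y - x) /\<^sub>R \<delta> - q))) \<le> 0"
    by (simp only: inner_scaleR_left inner_scaleR_right)
  then show ?thesis using \<open>\<delta> > 0\<close> by (simp only: mult_le_0_iff) auto
qed

text \<open>
  The rescaled sets \<open>(\<Omega> - x) / \<delta>\<close> increase as \<open>\<delta>\<close> decreases and exhaust the cone spanned by \<open>\<Omega> - x\<close>.
\<close>

lemma scaled_feasible:
  fixes x :: "'a::real_vector"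
  assumes "convex \<Omega>" "x \<in> \<Omega>" "y \<in> \<Omega>" "0 \<le> s" "0 < \<delta>" "s * \<delta> \<le> 1"
  obtains y' where "y' \<in> \<Omega>" "(y' - x) /\<^sub>R \<delta> = s *\<^sub>R (y - x)"
proof
  show "(1 - s * \<delta>) *\<^sub>R x + (s * \<delta>) *\<^sub>R y \<in> \<Omega>"
    using assms by (intro convexD) auto
  have eq: "(1 - s * \<delta>) *\<^sub>R x + (s * \<delta>) *\<^sub>R y - x = \<delta> *\<^sub>R (s *\<^sub>R (y - x))"
    by (simp add: algebra_simps)
  show "((1 - s * \<delta>) *\<^sub>R x + (s * \<delta>) *\<^sub>R y - x) /\<^sub>R \<delta> = s *\<^sub>R (y - x)"
    unfolding eq using \<open>0 < \<delta>\<close> by (simp only: scaleR_scaleR) simp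
qed

text \<open>
  The limit in the definition of the operator exists. The difference quotients are projections
  of \<open>v\<close> onto the convex sets \<open>(\<Omega> - x) / \<delta>\<close>, which grow as \<open>\<delta>\<close> decreases. So the distance from \<open>v\<close>
  decreases to its infimum, and the Pythagorean inequality between two nested projections turns
  this monotone convergence of distances into the Cauchy property of the quotients.
\<close>

lemma diff_proj_tendsto:
  fixes \<Omega> :: "'a::euclidean_space set"
  assumes \<Omega>: "closed \<Omega>" "convex \<Omega>" "x \<in> \<Omega>"
  shows "((\<lambda>\<delta>. (closest_point \<Omega> (x + \<delta> *\<^sub>R v) - x) /\<^sub>R \<delta>) \<longlongrightarrow> diff_proj \<Omega> x v) (at_right 0)"
proof -
  define q where "q \<delta> = (closest_point \<Omega> (x + \<delta> *\<^sub>R v) - x) /\<^sub>R \<delta>" for \<delta>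
  have inO: "closest_point \<Omega> w \<in> \<Omega>" for w using \<Omega> by (intro closest_point_in_set) auto
  have pyth: "(norm (v - q s))\<^sup>2 + (norm (q s - q t))\<^sup>2 \<le> (norm (v - q t))\<^sup>2" if "0 < s" "s \<le> t" for s t
  proof -
    obtain y' where y': "y' \<in> \<Omega>" "(y' - x) /\<^sub>R s = (1 / t) *\<^sub>R (closest_point \<Omega> (x + t *\<^sub>R v) - x)"
    proof (rule scaled_feasible[OF \<Omega>(2,3) inO[of "x + t *\<^sub>R v"], of "1 / t" s])
      show "0 \<le> 1 / t" "0 < s" "1 / t * s \<le> 1" using \<open>0 < s\<close> \<open>s \<le> t\<close> by simp_all
    qed
    then have "(y' - x) /\<^sub>R s = q t" by (simp add: q_def divide_inverse)
    then have "(v - q s) \<bullet> (q t - q s) \<le> 0"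
      using difference_quotient_variational[OF \<Omega> that(1) y'(1), of v] by (simp add: q_def)
    then show ?thesis
      by (simp add: power2_norm_eq_inner inner_diff_left inner_diff_right inner_commute algebra_simps)
  qed
  define D where "D \<delta> = (norm (v - q \<delta>))\<^sup>2" for \<delta>
  have bdd: "bdd_below (D ` {0<..})" by (intro bdd_belowI[of _ 0]) (auto simp: D_def)
  have cauchy: "\<exists>t>0. \<forall>s. 0 < s \<and> s \<le> t \<longrightarrow> norm (q s - q t) \<le> e" if "e > 0" for e
  proof -
    have "Inf (D ` {0<..}) < Inf (D ` {0<..}) + e\<^sup>2" using that by simp
    then have "\<exists>y\<in>D ` {0<..}. y < Inf (D ` {0<..}) + e\<^sup>2"
      by (subst (asm) cInf_less_iff[OF _ bdd]) auto
    then obtain t where t: "t > 0" "D t < Inf (D ` {0<..}) + e\<^sup>2" by auto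
    have "norm (q s - q t) \<le> e" if s: "0 < s" "s \<le> t" for s
    proof (rule power2_le_imp_le)
      have "Inf (D ` {0<..}) \<le> D s" using s bdd by (intro cInf_lower) auto
      then show "(norm (q s - q t))\<^sup>2 \<le> e\<^sup>2" using pyth[OF s] t unfolding D_def by linarith
    qed (use \<open>e > 0\<close> in simp)
    then show ?thesis using t by blast
  qed
  have small: "eventually (\<lambda>n. inverse (real (Suc n)) \<le> t) sequentially" if "t > 0" for t
    using order_tendstoD(2)[OF LIMSEQ_inverse_real_of_nat that] by (auto elim: eventually_mono)
  define a where "a n = q (inverse (real (Suc n)))" for n
  have "Cauchy a"
    unfolding Cauchy_altdef2
  proof (intro allI impI)
    fix e :: real assume "e > 0"
    then obtain t where t: "t > 0" "\<And>s. 0 < s \<Longrightarrow> s \<le> t \<Longrightarrow> norm (q s - q t) \<le> e / 3"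
      using cauchy[of "e / 3"] by auto
    obtain N where N: "\<And>n. n \<ge> N \<Longrightarrow> inverse (real (Suc n)) \<le> t"
      using small[OF t(1)] unfolding eventually_sequentially by blast
    have "dist (a n) (a N) < e" if "n \<ge> N" for n
    proof -
      have "dist (a n) (q t) \<le> e / 3" "dist (a N) (q t) \<le> e / 3"
        using t(2) N that unfolding a_def dist_norm by simp_all
      then show ?thesis using dist_triangle2[of "a n" "a N" "q t"] \<open>e > 0\<close> by linarith
    qed
    then show "\<exists>N. \<forall>n\<ge>N. dist (a n) (a N) < e" by blast
  qed
  then obtain l where al: "a \<longlonglongrightarrow> l" using Cauchy_convergent convergent_def by blast
  have "(q \<longlongrightarrow> l) (at_right 0)"
  proof (rule tendstoI)
    fix e :: real assume "e > 0"
    then obtain t where t: "t > 0" "\<And>s. 0 < s \<Longrightarrow> s \<le> t \<Longrightarrow> norm (q s - q t) \<le> e / 3"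
      using cauchy[of "e / 3"] by auto
    have "dist l (q t) \<le> e / 3"
    proof (rule tendsto_upperbound)
      show "(\<lambda>n. dist (a n) (q t)) \<longlonglongrightarrow> dist l (q t)" by (intro tendsto_intros al)
      show "\<forall>\<^sub>F n in sequentially. dist (a n) (q t) \<le> e / 3"
        using small[OF t(1)] by eventually_elim (use t(2) in \<open>simp add: a_def dist_norm\<close>)
    qed simp
    moreover have "\<forall>\<^sub>F s in at_right 0. s \<in> {0<..<t}"
      using t(1) by (rule eventually_at_right_real)
    ultimately show "\<forall>\<^sub>F s in at_right 0. dist (q s) l < e"
    proof (elim eventually_mono)
      fix s assume "dist l (q t) \<le> e / 3" "s \<in> {0<..<t}"
      moreover have "dist (q s) (q t) \<le> e / 3" using t(2)[of s] calculation by (auto simp: dist_norm)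
      ultimately show "dist (q s) l < e" using dist_triangle2[of "q s" l "q t"] \<open>e > 0\<close> by linarith
    qed
  qed
  note l = this
  then have "diff_proj \<Omega> x v = l"
    unfolding diff_proj_def q_def by (intro tendsto_Lim) auto
  then show ?thesis using l by (simp add: q_def[abs_def])
qed

text \<open>
  Passing to the limit in the inequality of the difference quotients, for all multiples \<open>s\<close> of a
  feasible direction at once. The case \<open>s = 0\<close> and the behaviour for large \<open>s\<close> give the norm bound
  and the normality of the residual.
\<close>

lemma diff_proj_variational_aux:
  fixes \<Omega> :: "'a::euclidean_space set"
  assumes \<Omega>: "closed \<Omega>" "convex \<Omega>" "x \<in> \<Omega>" and "y \<in> \<Omega>" "s \<ge> 0"
  shows "(v - diff_proj \<Omega> x v) \<bullet> (s *\<^sub>R (y - x) - diff_proj \<Omega> x v) \<le> 0"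
proof -
  define q where "q \<delta> = (closest_point \<Omega> (x + \<delta> *\<^sub>R v) - x) /\<^sub>R \<delta>" for \<delta>
  have q: "(q \<longlongrightarrow> diff_proj \<Omega> x v) (at_right 0)"
    using diff_proj_tendsto[OF \<Omega>] by (simp add: q_def[abs_def])
  show ?thesis
  proof (rule tendsto_upperbound)
    show "((\<lambda>\<delta>. (v - q \<delta>) \<bullet> (s *\<^sub>R (y - x) - q \<delta>)) \<longlongrightarrow>
        (v - diff_proj \<Omega> x v) \<bullet> (s *\<^sub>R (y - x) - diff_proj \<Omega> x v)) (at_right 0)"
      by (intro tendsto_intros q)
    have "\<forall>\<^sub>F \<delta> in at_right 0. \<delta> \<in> {0<..<1 / (s + 1)}"
      using \<open>s \<ge> 0\<close> by (intro eventually_at_right_real) simp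
    then show "\<forall>\<^sub>F \<delta> in at_right 0. (v - q \<delta>) \<bullet> (s *\<^sub>R (y - x) - q \<delta>) \<le> 0"
    proof eventually_elim
      case (elim \<delta>)
      then have "\<delta> > 0" "s * \<delta> \<le> 1" using \<open>s \<ge> 0\<close> by (auto simp: field_simps)
      then obtain y' where y': "y' \<in> \<Omega>" "(y' - x) /\<^sub>R \<delta> = s *\<^sub>R (y - x)"
        using scaled_feasible[OF \<Omega>(2,3) \<open>y \<in> \<Omega>\<close> \<open>s \<ge> 0\<close>] by blast
      then show ?case
        using difference_quotient_variational[OF \<Omega> \<open>\<delta> > 0\<close> y'(1), of v] by (simp add: q_def)
    qed
  qed simp
qed

text \<open>
  The residual \<open>v - diff_proj \<Omega> x v\<close> lies in the normal cone of \<open>\<Omega>\<close> at \<open>x\<close>: otherwise the left-hand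
  side of the auxiliary inequality would become positive for large \<open>s\<close>.
\<close>

lemma diff_proj_variational:
  fixes \<Omega> :: "'a::euclidean_space set"
  assumes \<Omega>: "closed \<Omega>" "convex \<Omega>" "x \<in> \<Omega>" and y: "y \<in> \<Omega>"
  shows "(v - diff_proj \<Omega> x v) \<bullet> (y - x) \<le> 0"
proof (rule ccontr)
  let ?w = "v - diff_proj \<Omega> x v"
  assume "\<not> ?thesis"
  then have pos: "?w \<bullet> (y - x) > 0" by simp
  \<comment> \<open>A multiple of \<open>y - x\<close> large enough to outweigh the constant term of the inequality.\<close>
  define s where "s = (\<bar>?w \<bullet> diff_proj \<Omega> x v\<bar> + 1) / (?w \<bullet> (y - x))"
  have "s \<ge> 0" using pos by (simp add: s_def)
  have "s * (?w \<bullet> (y - x)) = \<bar>?w \<bullet> diff_proj \<Omega> x v\<bar> + 1" using pos by (simp add: s_def)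
  moreover have "s * (?w \<bullet> (y - x)) - ?w \<bullet> diff_proj \<Omega> x v \<le> 0"
    using diff_proj_variational_aux[OF \<Omega> y \<open>s \<ge> 0\<close>, of v] by (simp only: inner_diff_right inner_scaleR_right)
  ultimately show False by linarith
qed

lemma norm_diff_proj_le:
  fixes \<Omega> :: "'a::euclidean_space set"
  assumes \<Omega>: "closed \<Omega>" "convex \<Omega>" "x \<in> \<Omega>"
  shows "norm (diff_proj \<Omega> x v) \<le> norm v"
proof (rule power2_le_imp_le)
  let ?p = "diff_proj \<Omega> x v"
  have "(v - ?p) \<bullet> (0 - ?p) \<le> 0"
    using diff_proj_variational_aux[OF \<Omega> \<Omega>(3), of 0 v] by simp
  moreover have "(norm v)\<^sup>2 = (norm (v - ?p))\<^sup>2 - 2 * ((v - ?p) \<bullet> (0 - ?p)) + (norm ?p)\<^sup>2"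
    by (simp add: power2_norm_eq_inner inner_diff_left inner_diff_right inner_commute algebra_simps)
  ultimately show "(norm ?p)\<^sup>2 \<le> (norm v)\<^sup>2" by (smt (verit) zero_le_power2)
qed simp

text \<open>
  A normal vector does not move the projection, so all difference quotients vanish.
\<close>

lemma diff_proj_eq_0:
  fixes \<Omega> :: "'a::euclidean_space set"
  assumes \<Omega>: "closed \<Omega>" "convex \<Omega>" "x \<in> \<Omega>" and normal: "\<And>y. y \<in> \<Omega> \<Longrightarrow> v \<bullet> (y - x) \<le> 0"
  shows "diff_proj \<Omega> x v = 0"
proof -
  have "closest_point \<Omega> (x + \<delta> *\<^sub>R v) = x" if "\<delta> > 0" for \<delta>
  proof (rule closest_point_unique[symmetric, OF \<Omega>(2,1,3)], rule ballI)
    fix y assume "y \<in> \<Omega>"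
    have "(norm (\<delta> *\<^sub>R v))\<^sup>2 + (norm (y - x))\<^sup>2 - 2 * (\<delta> * (v \<bullet> (y - x))) = (norm (x + \<delta> *\<^sub>R v - y))\<^sup>2"
      unfolding power2_norm_eq_inner
      by (simp add: inner_diff_left inner_diff_right inner_add_left inner_add_right inner_commute algebra_simps)
    moreover have "\<delta> * (v \<bullet> (y - x)) \<le> 0"
      using normal[OF \<open>y \<in> \<Omega>\<close>] that by (simp add: mult_nonneg_nonpos)
    ultimately have "(norm (\<delta> *\<^sub>R v))\<^sup>2 \<le> (norm (x + \<delta> *\<^sub>R v - y))\<^sup>2" by (smt (verit) zero_le_power2)
    then have "norm (\<delta> *\<^sub>R v) \<le> norm (x + \<delta> *\<^sub>R v - y)" by (rule power2_le_imp_le) simp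
    then show "dist (x + \<delta> *\<^sub>R v) x \<le> dist (x + \<delta> *\<^sub>R v) y"
      by (simp only: dist_norm add_diff_cancel_left')
  qed
  then have "\<forall>\<^sub>F \<delta> in at_right 0. (closest_point \<Omega> (x + \<delta> *\<^sub>R v) - x) /\<^sub>R \<delta> = 0"
    by (intro eventually_mono[OF eventually_at_right_less[of "0::real"]]) simp
  then have "((\<lambda>\<delta>. (closest_point \<Omega> (x + \<delta> *\<^sub>R v) - x) /\<^sub>R \<delta>) \<longlongrightarrow> 0) (at_right 0)"
    by (rule tendsto_eventually)
  with diff_proj_tendsto[OF \<Omega>] show ?thesis by (rule tendsto_unique[OF trivial_limit_at_right_real])
qed
section \<open>Convergence of projected saddle flows\<close>

text \<open>
  For a positive semidefinite \<open>L\<close> the quadratic form controls the image: test the form with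
  \<open>B v - L v\<close>.
\<close>

lemma psd_norm_bound:
  fixes L :: "'a::euclidean_space \<Rightarrow> 'a"
  assumes lin: "linear L" and sym: "\<And>u v. L u \<bullet> v = u \<bullet> L v" and psd: "\<And>u. 0 \<le> u \<bullet> L u"
    and B: "B > 0" "\<And>v. norm (L v) \<le> B * norm v"
  shows "(norm (L v))\<^sup>2 \<le> B * (v \<bullet> L v)"
proof -
  let ?w = "L v"
  have "0 \<le> (B *\<^sub>R v - ?w) \<bullet> L (B *\<^sub>R v - ?w)" by (rule psd)
  also have "\<dots> = B * B * (v \<bullet> ?w) - B * (v \<bullet> L ?w) - B * (?w \<bullet> ?w) + ?w \<bullet> L ?w"
    by (simp add: linear_diff[OF lin] linear_scale[OF lin] inner_diff_left inner_diff_right algebra_simps)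
  also have "v \<bullet> L ?w = ?w \<bullet> ?w" by (rule sym[symmetric])
  also have "?w \<bullet> L ?w \<le> norm ?w * (B * norm ?w)"
    by (rule order_trans[OF norm_cauchy_schwarz]) (intro mult_left_mono B norm_ge_zero)
  finally have "0 \<le> B * (B * (v \<bullet> ?w) - (norm ?w)\<^sup>2)"
    by (simp add: power2_norm_eq_inner[symmetric] power2_eq_square algebra_simps)
  then show ?thesis using B(1) by (simp add: zero_le_mult_iff)
qed

text \<open>
  The abstract data of the algorithm: a strongly monotone map \<open>G\<close> in place of the stacked gradients
  and a symmetric positive semidefinite \<open>L\<close> in place of the Laplacian. The constraint set \<open>K\<close> and
  the resource vector \<open>p\<close> enter through the definitions below.
\<close>

locale saddle_flow =
  fixes K :: "'a::euclidean_space set" and G L :: "'a \<Rightarrow> 'a" and p :: 'a and \<mu> :: real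
  assumes lin: "linear L" and sym: "\<And>u v. L u \<bullet> v = u \<bullet> L v" and psd: "\<And>u. 0 \<le> u \<bullet> L u"
    and mu: "\<mu> > 0" and mono: "\<And>u v. \<mu> * (norm (u - v))\<^sup>2 \<le> (u - v) \<bullet> (G u - G v)"
    and cont: "continuous_on UNIV G"
begin

text \<open>
  The stationarity conditions of the saddle flow after simplification: the third equation gives
  \<open>L l = 0\<close>, which turns the second into \<open>L z = p - x\<close>; the first says that \<open>l - G x\<close> is normal to \<open>K\<close>
  at \<open>x\<close>.
\<close>

definition equil :: "'a \<times> 'a \<times> 'a \<Rightarrow> bool" where
  "equil = (\<lambda>(x, l, z). x \<in> K \<and> (\<forall>y\<in>K. (l - G x) \<bullet> (y - x) \<le> 0) \<and> L l = 0 \<and> L z = p - x)"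

definition velocity :: "'a \<times> 'a \<times> 'a \<Rightarrow> 'a \<Rightarrow> 'a \<times> 'a \<times> 'a" where
  "velocity = (\<lambda>(x, l, z) v. (v, - L l - L z + (p - x), L l))"

text \<open>
  The two properties of the projected velocity \<open>v = \<Pi>\<^sub>K(x, l - G x)\<close> from which everything else is
  derived. Using them instead of the projection keeps the product structure of \<open>K\<close> out of the
  analysis.
\<close>

definition admissible :: "'a \<times> 'a \<times> 'a \<Rightarrow> 'a \<Rightarrow> bool" where
  "admissible = (\<lambda>(x, l, z) v. (\<forall>y\<in>K. (l - G x - v) \<bullet> (y - x) \<le> 0) \<and> norm v \<le> norm (l - G x))"

definition flow :: "(real \<Rightarrow> 'a \<times> 'a \<times> 'a) \<Rightarrow> bool" where
  "flow S \<longleftrightarrow> (\<forall>T\<ge>0. abs_continuous_on 0 T S) \<and> (\<forall>t\<ge>0. fst (S t) \<in> K) \<and>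
     (AE t in lebesgue. t \<ge> 0 \<longrightarrow>
        (\<exists>v. admissible (S t) v \<and> (S has_vector_derivative velocity (S t) v) (at t within {0..})))"

lemma flow_abs_continuous: "flow S \<Longrightarrow> T \<ge> 0 \<Longrightarrow> abs_continuous_on 0 T S"
  by (simp add: flow_def)

lemma flow_in_K: "flow S \<Longrightarrow> t \<ge> 0 \<Longrightarrow> fst (S t) \<in> K"
  by (simp add: flow_def)

text \<open>
  Transfers a pointwise consequence of the differential inclusion to almost all times.
\<close>

lemma flow_AE_D:
  assumes "flow S"
    and "\<And>t v. \<lbrakk>t \<ge> 0; admissible (S t) v; (S has_vector_derivative velocity (S t) v) (at t within {0..})\<rbrakk>
       \<Longrightarrow> P t"
  shows "AE t in lebesgue. t \<ge> 0 \<longrightarrow> P t"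
proof -
  have "AE t in lebesgue. t \<ge> 0 \<longrightarrow>
     (\<exists>v. admissible (S t) v \<and> (S has_vector_derivative velocity (S t) v) (at t within {0..}))"
    using assms(1) by (simp add: flow_def)
  then show ?thesis
    by eventually_elim (use assms(2) in blast)
qed

lemma L_bounded: obtains B where "B \<ge> 1" "\<And>v. norm (L v) \<le> B * norm v"
proof -
  obtain B where B: "\<And>v. norm (L v) \<le> B * norm v" using linear_bounded[OF lin] by blast
  have "norm (L v) \<le> max B 1 * norm v" for v
    using B[of v] by (rule order_trans) (intro mult_right_mono, auto)
  then show ?thesis using that[of "max B 1"] by simp
qed

lemma cont_L: "continuous_on A L"
  by (rule linear_continuous_on) (simp add: lin linear_conv_bounded_linear[symmetric])

text \<open>
  With the deviations \<open>a\<close>, \<open>b\<close>, \<open>c\<close> from the equilibrium, the coupling terms \<open>a \<bullet> b\<close> and \<open>b \<bullet> L c\<close> occur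
  twice with opposite signs. What remains is controlled by the two variational inequalities,
  strong monotonicity of \<open>G\<close>, and \<open>b \<bullet> L b = l \<bullet> L l\<close>.
\<close>

lemma dissipation:
  assumes eq: "equil (x0, l0, z0)" and adm: "admissible (x, l, z) v" and x: "x \<in> K"
  shows "((x, l, z) - (x0, l0, z0)) \<bullet> velocity (x, l, z) v \<le> - (\<mu> * (norm (x - x0))\<^sup>2 + l \<bullet> L l)"
proof -
  define a b c where abc: "a = x - x0" "b = l - l0" "c = z - z0"
  have x0: "x0 \<in> K" and opt: "(l0 - G x0) \<bullet> a \<le> 0" and l0: "L l0 = 0" and z0: "L z0 = p - x0"
    using eq x by (auto simp: equil_def abc)
  have Lb: "L l = L b" using l0 by (simp add: abc linear_diff[OF lin])
  have Lz: "L z = L c + (p - x0)" using z0 by (simp add: abc linear_diff[OF lin])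
  have "(l - G x - v) \<bullet> (x0 - x) \<le> 0" using adm x0 by (auto simp: admissible_def)
  then have "a \<bullet> v \<le> a \<bullet> (l - G x)"
    by (simp add: abc inner_diff_left inner_diff_right inner_commute algebra_simps)
  also have "\<dots> = a \<bullet> b - a \<bullet> (G x - G x0) + (l0 - G x0) \<bullet> a"
    by (simp add: abc(2) inner_diff_right inner_diff_left inner_commute[of a])
  also have "\<dots> \<le> a \<bullet> b - \<mu> * (norm a)\<^sup>2" using mono[of x x0] opt by (simp add: abc)
  finally have 1: "a \<bullet> v \<le> a \<bullet> b - \<mu> * (norm a)\<^sup>2" .
  have "- L l - L z + (p - x) = - L b - L c - a" by (simp add: Lb Lz abc(1))
  then have 2: "b \<bullet> (- L l - L z + (p - x)) = - (b \<bullet> L b) - b \<bullet> L c - a \<bullet> b"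
    by (simp add: inner_diff_right inner_commute)
  have 3: "c \<bullet> L l = b \<bullet> L c" by (metis Lb sym inner_commute)
  have 4: "b \<bullet> L b = l \<bullet> L l"
  proof -
    have "l0 \<bullet> L l = 0" by (metis l0 sym inner_zero_left)
    then show ?thesis unfolding Lb[symmetric] by (simp add: abc(2) inner_diff_left)
  qed
  have "((x, l, z) - (x0, l0, z0)) \<bullet> velocity (x, l, z) v
      = a \<bullet> v + (b \<bullet> (- L l - L z + (p - x)) + c \<bullet> L l)"
    by (simp add: velocity_def abc inner_prod_def)
  then show ?thesis using 1 2 3 4 unfolding abc(1) by linarith
qed

definition energy :: "'a \<times> 'a \<times> 'a \<Rightarrow> 'a \<times> 'a \<times> 'a \<Rightarrow> real" where
  "energy S0 S = (S - S0) \<bullet> (S - S0) / 2"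

lemma energy_abs_continuous:
  assumes "flow S" "T \<ge> 0"
  shows "abs_continuous_on 0 T (\<lambda>t. energy S0 (S t))"
  unfolding energy_def
  by (intro abs_continuous_on_bounded_linear[of "\<lambda>r. r / 2"] bounded_linear_divide
      abs_continuous_on_inner abs_continuous_on_diff abs_continuous_on_const flow_abs_continuous assms)

lemma energy_deriv:
  assumes "(S has_vector_derivative D) (at t within A)"
  shows "((\<lambda>t. energy S0 (S t)) has_real_derivative (S t - S0) \<bullet> D) (at t within A)"
proof -
  have d: "((\<lambda>t. S t - S0) has_vector_derivative D) (at t within A)"
    using assms by (auto intro!: derivative_eq_intros)
  have "((\<lambda>t. (S t - S0) \<bullet> (S t - S0)) has_real_derivative 2 * ((S t - S0) \<bullet> D)) (at t within A)"
    using has_real_derivative_inner[OF d d] by (simp add: inner_commute)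
  then have "((\<lambda>t. (S t - S0) \<bullet> (S t - S0) / 2) has_real_derivative 2 * ((S t - S0) \<bullet> D) / 2) (at t within A)"
    by (rule DERIV_cdivide)
  then show ?thesis by (simp add: energy_def)
qed

lemma energy_dissipation:
  assumes "flow S" "equil (x0, l0, z0)"
  shows "AE t in lebesgue. t \<ge> 0 \<longrightarrow> (\<exists>D. D \<le> - (\<mu> * (norm (fst (S t) - x0))\<^sup>2
      + fst (snd (S t)) \<bullet> L (fst (snd (S t)))) \<and>
     ((\<lambda>t. energy (x0, l0, z0) (S t)) has_real_derivative D) (at t within {0..}))"
proof (rule flow_AE_D[OF assms(1)])
  fix t v assume t: "t \<ge> 0" and adm: "admissible (S t) v"
    and d: "(S has_vector_derivative velocity (S t) v) (at t within {0..})"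
  show "\<exists>D. D \<le> - (\<mu> * (norm (fst (S t) - x0))\<^sup>2 + fst (snd (S t)) \<bullet> L (fst (snd (S t)))) \<and>
     ((\<lambda>t. energy (x0, l0, z0) (S t)) has_real_derivative D) (at t within {0..})"
    using energy_deriv[OF d, of "(x0, l0, z0)"] dissipation[OF assms(2), of "fst (S t)" "fst (snd (S t))" "snd (snd (S t))" v]
      adm flow_in_K[OF assms(1) t] by auto
qed

lemma energy_nonincreasing:
  assumes "flow S" "equil S0" "0 \<le> s" "s \<le> t"
  shows "energy S0 (S t) \<le> energy S0 (S s)"
proof (rule nonincreasing_halfline[OF _ _ assms(3,4)])
  obtain x0 l0 z0 where S0: "S0 = (x0, l0, z0)" by (cases S0)
  show "AE t in lebesgue. t \<ge> 0 \<longrightarrow>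
      (\<exists>D\<le>0. ((\<lambda>t. energy S0 (S t)) has_real_derivative D) (at t within {0..}))"
    using energy_dissipation[OF assms(1) assms(2)[unfolded S0]]
  proof eventually_elim
    case (elim t)
    have "0 \<le> \<mu> * (norm (fst (S t) - x0))\<^sup>2 + fst (snd (S t)) \<bullet> L (fst (snd (S t)))"
      using psd mu by (intro add_nonneg_nonneg mult_nonneg_nonneg) auto
    then show ?case using elim unfolding S0 by (meson neg_le_0_iff_le order_trans)
  qed
qed (rule energy_abs_continuous[OF assms(1)])

lemma energy_eq: "energy S0 S = (norm (S - S0))\<^sup>2 / 2"
  by (simp add: energy_def power2_norm_eq_inner)

lemma flow_bounded:
  assumes "flow S" "equil S0"
  obtains R where "\<And>t. t \<ge> 0 \<Longrightarrow> S t \<in> cball 0 R"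
proof (rule that)
  fix t :: real assume "t \<ge> 0"
  then have "norm (S t - S0) \<le> norm (S 0 - S0)"
    using energy_nonincreasing[OF assms, of 0 t] by (simp add: energy_eq power_mono_iff)
  then show "S t \<in> cball 0 (norm S0 + norm (S 0 - S0))"
    using norm_triangle_ineq[of S0 "S t - S0"] by simp
qed

text \<open>
  The trajectory stays in a ball, where the velocity is bounded. It is therefore Lipschitz, and \<open>\<phi>\<close> is
  uniformly continuous on the ball. This supplies the hypothesis of the Barbalat lemmas.
\<close>

lemma flow_uniformly_continuous:
  fixes \<phi> :: "'a \<times> 'a \<times> 'a \<Rightarrow> 'b::metric_space"
  assumes S: "flow S" "equil S0" and \<phi>: "continuous_on UNIV \<phi>"
  shows "uniformly_continuous_on {0..} (\<lambda>t. \<phi> (S t))"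
proof -
  obtain R where R: "\<And>t. t \<ge> 0 \<Longrightarrow> S t \<in> cball 0 R" using flow_bounded[OF S] by blast
  define h where "h = (\<lambda>(x, l, z). norm (l - G x) + (norm (- L l - L z + (p - x)) + norm (L l)))"
  have "continuous_on UNIV h"
    unfolding h_def case_prod_unfold
    by (intro continuous_intros continuous_on_compose2[OF cont] continuous_on_compose2[OF cont_L[of UNIV]]) auto
  then have "bounded (h ` cball 0 R)"
    by (intro compact_imp_bounded compact_continuous_image) (auto intro: continuous_on_subset)
  then obtain B where B: "\<And>s. s \<in> cball 0 R \<Longrightarrow> h s \<le> B" "B \<ge> 0"
    unfolding bounded_iff by (metis abs_le_D1 image_eqI order_trans real_norm_def norm_ge_zero linear)
  have speed: "norm (velocity s v) \<le> h s" if "admissible s v" for s v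
  proof -
    obtain x l z where s: "s = (x, l, z)" by (cases s)
    have "norm (velocity s v) \<le> norm v + norm (- L l - L z + (p - x), L l)"
      unfolding s velocity_def by (simp add: norm_Pair_le)
    also have "\<dots> \<le> norm v + (norm (- L l - L z + (p - x)) + norm (L l))"
      by (intro add_left_mono norm_Pair_le)
    also have "\<dots> \<le> h s" using that by (simp add: s h_def admissible_def)
    finally show ?thesis .
  qed
  have "B-lipschitz_on {0..} S"
  proof (rule lipschitz_halfline[OF flow_abs_continuous[OF S(1)] B(2)])
    show "AE t in lebesgue. t \<ge> 0 \<longrightarrow>
      (\<exists>D. norm D \<le> B \<and> (S has_vector_derivative D) (at t within {0..}))"
      by (rule flow_AE_D[OF S(1)]) (meson speed R B(1) order_trans)
  qed
  then have uc: "uniformly_continuous_on {0..} S" by (rule lipschitz_on_uniformly_continuous)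
  have "uniformly_continuous_on (cball 0 R) \<phi>"
    by (intro compact_uniformly_continuous continuous_on_subset[OF \<phi>]) auto
  moreover have "S ` {0..} \<subseteq> cball 0 R" using R by auto
  ultimately have "uniformly_continuous_on (S ` {0..}) \<phi>"
    unfolding uniformly_continuous_on_def by (meson subsetD)
  with uc show ?thesis by (rule uniformly_continuous_on_compose)
qed

text \<open>
  Barbalat's lemma for the energy: its dissipation rate tends to zero, and so does each of its two
  nonnegative parts.
\<close>

lemma flow_x_limit_L_limit:
  assumes S: "flow S" and eq: "equil (x0, l0, z0)"
  shows "((\<lambda>t. fst (S t)) \<longlongrightarrow> x0) at_top" "((\<lambda>t. L (fst (snd (S t)))) \<longlongrightarrow> 0) at_top"
proof -
  define \<phi> where "\<phi> s = \<mu> * (norm (fst s - x0))\<^sup>2 + fst (snd s) \<bullet> L (fst (snd s))" for s :: "'a \<times> 'a \<times> 'a"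
  obtain l where l: "((\<lambda>t. energy (x0, l0, z0) (S t)) \<longlongrightarrow> l) at_top"
    using nonincreasing_convergent[of "\<lambda>t. energy (x0, l0, z0) (S t)"] energy_nonincreasing[OF S eq]
    by (auto simp: energy_eq)
  have "continuous_on UNIV \<phi>"
    unfolding \<phi>_def by (intro continuous_intros continuous_on_compose2[OF cont_L[of UNIV]]) auto
  then have small: "\<forall>\<^sub>F t in at_top. \<phi> (S t) < e" if "e > 0" for e
    using barbalat_one_sided[OF energy_abs_continuous[OF S] l
      energy_dissipation[OF S eq, folded \<phi>_def] flow_uniformly_continuous[OF S eq] that] by blast
  have nonneg: "0 \<le> \<mu> * (norm (fst s - x0))\<^sup>2" "0 \<le> fst (snd s) \<bullet> L (fst (snd s))" for s :: "'a \<times> 'a \<times> 'a"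
    using mu psd by auto
  have \<phi>0: "((\<lambda>t. \<phi> (S t)) \<longlongrightarrow> 0) at_top"
  proof (rule order_tendstoI)
    fix a :: real assume "a < 0"
    moreover have "0 \<le> \<phi> s" for s using nonneg[of s] by (simp add: \<phi>_def)
    ultimately show "\<forall>\<^sub>F t in at_top. a < \<phi> (S t)"
      by (intro always_eventually) (meson less_le_trans)
  qed (rule small)
  have square: "(f \<longlongrightarrow> 0) at_top" if "\<And>t. (norm (f t))\<^sup>2 \<le> c * \<phi> (S t)" for f :: "real \<Rightarrow> 'a" and c
  proof -
    have "((\<lambda>t. sqrt (c * \<phi> (S t))) \<longlongrightarrow> sqrt (c * 0)) at_top" by (intro tendsto_intros \<phi>0)
    then have "((\<lambda>t. sqrt (c * \<phi> (S t))) \<longlongrightarrow> 0) at_top" by simp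
    then show ?thesis
      by (rule Lim_null_comparison[rotated]) (intro always_eventually allI real_le_rsqrt that)
  qed
  have "((\<lambda>t. fst (S t) - x0) \<longlongrightarrow> 0) at_top"
  proof (rule square[of _ "1 / \<mu>"])
    fix t
    show "(norm (fst (S t) - x0))\<^sup>2 \<le> 1 / \<mu> * \<phi> (S t)"
      using mu nonneg[of "S t"] by (simp add: \<phi>_def field_simps)
  qed
  then show "((\<lambda>t. fst (S t)) \<longlongrightarrow> x0) at_top" by (rule LIM_zero_cancel)
  obtain B where B: "B \<ge> 1" "\<And>v. norm (L v) \<le> B * norm v" using L_bounded by blast
  show "((\<lambda>t. L (fst (snd (S t)))) \<longlongrightarrow> 0) at_top"
  proof (rule square[of _ B])
    fix t
    have "(norm (L (fst (snd (S t)))))\<^sup>2 \<le> B * (fst (snd (S t)) \<bullet> L (fst (snd (S t))))"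
      using B(1) by (intro psd_norm_bound lin sym psd B(2)) auto
    also have "\<dots> \<le> B * \<phi> (S t)"
      using B(1) nonneg(1)[of "S t"] by (intro mult_left_mono) (auto simp: \<phi>_def)
    finally show "(norm (L (fst (snd (S t)))))\<^sup>2 \<le> B * \<phi> (S t)" .
  qed
qed

text \<open>
  Since \<open>L l\<close> converges, Barbalat's lemma makes its derivative \<open>w\<close> tend to zero, and in \<open>w\<close> every
  term other than \<open>L (L (z - z0))\<close> is already known to vanish. Finally \<open>L (L c)\<close> controls \<open>L c\<close>,
  because \<open>(norm (L c))\<^sup>2 = c \<bullet> L (L c)\<close> and \<open>c\<close> is bounded.
\<close>

lemma flow_Lz_limit:
  assumes S: "flow S" and eq: "equil (x0, l0, z0)"
  shows "((\<lambda>t. L (snd (snd (S t)))) \<longlongrightarrow> p - x0) at_top"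
proof -
  let ?x = "\<lambda>t. fst (S t)" and ?l = "\<lambda>t. fst (snd (S t))" and ?z = "\<lambda>t. snd (snd (S t))"
  have L0: "L 0 = 0" by (rule linear_0[OF lin])
  have z0: "L z0 = p - x0" using eq by (simp add: equil_def)
  have bl: "bounded_linear L" using lin by (simp add: linear_conv_bounded_linear)
  note Ltend = bounded_linear.tendsto[OF bl]
  define w where "w s = L (- L (fst (snd s)) - L (snd (snd s)) + (p - fst s))" for s :: "'a \<times> 'a \<times> 'a"
  have "((\<lambda>t. w (S t)) \<longlongrightarrow> 0) at_top"
  proof (rule barbalat[OF _ flow_x_limit_L_limit(2)[OF S eq]])
    show "abs_continuous_on 0 T (\<lambda>t. L (?l t))" if "T \<ge> 0" for T
      by (intro abs_continuous_on_bounded_linear[OF bl] abs_continuous_on_bounded_linear[OF bounded_linear_fst]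
          abs_continuous_on_bounded_linear[OF bounded_linear_snd] flow_abs_continuous S that)
    show "AE t in lebesgue. t \<ge> 0 \<longrightarrow> ((\<lambda>t. L (?l t)) has_vector_derivative w (S t)) (at t within {0..})"
    proof (rule flow_AE_D[OF S])
      fix t v assume "(S has_vector_derivative velocity (S t) v) (at t within {0..})"
      from bounded_linear.has_vector_derivative[OF bounded_linear_compose[OF bl
          bounded_linear_compose[OF bounded_linear_fst bounded_linear_snd]] this]
      show "((\<lambda>t. L (?l t)) has_vector_derivative w (S t)) (at t within {0..})"
        by (simp add: w_def velocity_def case_prod_unfold)
    qed
    have "continuous_on UNIV w"
      unfolding w_def by (intro continuous_intros continuous_on_compose2[OF cont_L[of UNIV]]) auto
    then show "uniformly_continuous_on {0..} (\<lambda>t. w (S t))" by (rule flow_uniformly_continuous[OF S eq])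
  qed
  moreover have "((\<lambda>t. L (L (?l t))) \<longlongrightarrow> L 0) at_top"
    by (intro Ltend flow_x_limit_L_limit[OF S eq])
  moreover have "((\<lambda>t. L (?x t - x0)) \<longlongrightarrow> L (x0 - x0)) at_top"
    by (intro Ltend tendsto_intros flow_x_limit_L_limit[OF S eq])
  ultimately have "((\<lambda>t. - (w (S t) + L (L (?l t)) + L (?x t - x0))) \<longlongrightarrow> - (0 + L 0 + L (x0 - x0))) at_top"
    by (intro tendsto_intros)
  moreover have "- (w (S t) + L (L (?l t)) + L (?x t - x0)) = L (L (?z t - z0))" for t
    by (simp add: w_def linear_diff[OF lin] linear_add[OF lin] linear_neg[OF lin] z0)
  ultimately have LL: "((\<lambda>t. L (L (?z t - z0))) \<longlongrightarrow> 0) at_top" by (simp add: L0)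
  obtain R where R: "\<And>t. t \<ge> 0 \<Longrightarrow> S t \<in> cball 0 R" using flow_bounded[OF S eq] by blast
  have zb: "norm (?z t - z0) \<le> R + norm z0" if "t \<ge> 0" for t
  proof -
    have "norm (?z t) \<le> norm (S t)" by (metis norm_snd_le order_trans prod.collapse)
    then show ?thesis using R[OF that] norm_triangle_ineq4[of "?z t" z0] by simp
  qed
  have "((\<lambda>t. sqrt ((R + norm z0) * norm (L (L (?z t - z0))))) \<longlongrightarrow> sqrt ((R + norm z0) * norm (0::'a))) at_top"
    by (intro tendsto_intros LL)
  then have "((\<lambda>t. sqrt ((R + norm z0) * norm (L (L (?z t - z0))))) \<longlongrightarrow> 0) at_top" by simp
  then have "((\<lambda>t. L (?z t - z0)) \<longlongrightarrow> 0) at_top"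
  proof (rule Lim_null_comparison[rotated])
    show "\<forall>\<^sub>F t in at_top. norm (L (?z t - z0)) \<le> sqrt ((R + norm z0) * norm (L (L (?z t - z0))))"
      using eventually_ge_at_top[of 0]
    proof eventually_elim
      case (elim t)
      have "(norm (L (?z t - z0)))\<^sup>2 = (?z t - z0) \<bullet> L (L (?z t - z0))"
        by (simp add: power2_norm_eq_inner sym)
      also have "\<dots> \<le> norm (?z t - z0) * norm (L (L (?z t - z0)))" by (rule norm_cauchy_schwarz)
      also have "\<dots> \<le> (R + norm z0) * norm (L (L (?z t - z0)))"
        by (intro mult_right_mono zb elim norm_ge_zero)
      finally show ?case by (rule real_le_rsqrt)
    qed
  qed
  then have "((\<lambda>t. L (?z t) - (p - x0)) \<longlongrightarrow> 0) at_top" by (simp add: linear_diff[OF lin] z0)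
  then show ?thesis by (rule LIM_zero_cancel)
qed

text \<open>
  Half the squared distance \<open>V\<close> of \<open>x\<close> from a fixed \<open>y \<in> K\<close> converges because \<open>x\<close> does, and by
  admissibility it decreases at least at the rate \<open>(l - G x) \<bullet> (y - x)\<close>. No positive lower bound on
  this rate can persist.
\<close>

lemma flow_variational_limsup:
  assumes S: "flow S" and eq: "equil (x0, l0, z0)" and y: "y \<in> K" and "e > 0"
  shows "\<forall>\<^sub>F t in at_top. (fst (snd (S t)) - G (fst (S t))) \<bullet> (y - fst (S t)) < e"
proof -
  define q where "q s = (fst (snd s) - G (fst s)) \<bullet> (y - fst s)" for s :: "'a \<times> 'a \<times> 'a"
  define V where "V t = (y - fst (S t)) \<bullet> (y - fst (S t)) / 2" for t
  have "\<forall>\<^sub>F t in at_top. q (S t) < e"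
  proof (rule barbalat_one_sided[where V = V])
    show "abs_continuous_on 0 T V" if "T \<ge> 0" for T
      unfolding V_def
      by (intro abs_continuous_on_bounded_linear[of "\<lambda>r. r / 2"] bounded_linear_divide
        abs_continuous_on_inner abs_continuous_on_diff abs_continuous_on_const
        abs_continuous_on_bounded_linear[OF bounded_linear_fst] flow_abs_continuous[OF S] that)
    show "(V \<longlongrightarrow> (y - x0) \<bullet> (y - x0) / 2) at_top"
      unfolding V_def by (intro tendsto_intros flow_x_limit_L_limit[OF S eq]) auto
    show "AE t in lebesgue. t \<ge> 0 \<longrightarrow> (\<exists>D. D \<le> - q (S t) \<and> (V has_real_derivative D) (at t within {0..}))"
    proof (rule flow_AE_D[OF S])
      fix t v assume adm: "admissible (S t) v"
        and d: "(S has_vector_derivative velocity (S t) v) (at t within {0..})"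
      have "((\<lambda>t. fst (S t)) has_vector_derivative v) (at t within {0..})"
        using bounded_linear.has_vector_derivative[OF bounded_linear_fst d]
        by (simp add: velocity_def case_prod_unfold)
      then have d': "((\<lambda>t. y - fst (S t)) has_vector_derivative - v) (at t within {0..})"
        by (auto intro!: derivative_eq_intros)
      have "((\<lambda>t. (y - fst (S t)) \<bullet> (y - fst (S t))) has_real_derivative 2 * - (v \<bullet> (y - fst (S t)))) (at t within {0..})"
        using has_real_derivative_inner[OF d' d'] by (simp add: inner_commute)
      then have "(V has_real_derivative 2 * - (v \<bullet> (y - fst (S t))) / 2) (at t within {0..})"
        unfolding V_def by (rule DERIV_cdivide)
      moreover have "(fst (snd (S t)) - G (fst (S t)) - v) \<bullet> (y - fst (S t)) \<le> 0"
        using adm y by (auto simp: admissible_def case_prod_unfold)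
      then have "q (S t) \<le> v \<bullet> (y - fst (S t))" by (simp add: q_def inner_diff_left)
      ultimately show "\<exists>D. D \<le> - q (S t) \<and> (V has_real_derivative D) (at t within {0..})"
        by (intro exI[of _ "2 * - (v \<bullet> (y - fst (S t))) / 2"]) simp
    qed
    have "continuous_on UNIV q"
      unfolding q_def by (intro continuous_intros continuous_on_compose2[OF cont]) auto
    then show "uniformly_continuous_on {0..} (\<lambda>t. q (S t))" by (rule flow_uniformly_continuous[OF S eq])
  qed fact
  then show ?thesis by (simp add: q_def)
qed

text \<open>
  A bounded trajectory has a limit point along some sequence of times \<open>\<tau> n\<close>. The preceding limits
  show that it is an equilibrium. The distance to this equilibrium is nonincreasing and gets
  arbitrarily small along the subsequence, so it tends to zero.
\<close>

theorem flow_converges: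
  assumes S: "flow S" and eq: "equil S0"
  shows "\<exists>S'. equil S' \<and> (S \<longlongrightarrow> S') at_top"
proof -
  obtain x0 l0 z0 where S0: "S0 = (x0, l0, z0)" by (cases S0)
  note eq0 = eq[unfolded S0]
  obtain R where R: "\<And>t. t \<ge> 0 \<Longrightarrow> S t \<in> cball 0 R" using flow_bounded[OF S eq] by blast
  have "seq_compact (cball (0::'a \<times> 'a \<times> 'a) R)" by (simp add: compact_eq_seq_compact_metric[symmetric])
  moreover have "\<forall>n. S (real n) \<in> cball 0 R" using R by simp
  ultimately obtain S' r where r: "strict_mono r" and lim: "((\<lambda>n. S (real n)) \<circ> r) \<longlonglongrightarrow> S'"
    unfolding seq_compact_def by meson
  define \<tau> where "\<tau> n = real (r n)" for n
  have \<tau>: "filterlim \<tau> at_top sequentially"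
    unfolding \<tau>_def using r by (intro filterlim_compose[OF filterlim_real_sequentially] filterlim_subseq)
  have lim: "(\<lambda>n. S (\<tau> n)) \<longlonglongrightarrow> S'" using lim by (simp add: \<tau>_def o_def)
  obtain x1 l1 z1 where S': "S' = (x1, l1, z1)" by (cases S')
  have x1: "(\<lambda>n. fst (S (\<tau> n))) \<longlonglongrightarrow> x1" and l1: "(\<lambda>n. fst (snd (S (\<tau> n)))) \<longlonglongrightarrow> l1"
    and z1: "(\<lambda>n. snd (snd (S (\<tau> n)))) \<longlonglongrightarrow> z1"
    using tendsto_fst[OF lim] tendsto_fst[OF tendsto_snd[OF lim]] tendsto_snd[OF tendsto_snd[OF lim]]
    by (simp_all add: S')
  have bl: "bounded_linear L" using lin by (simp add: linear_conv_bounded_linear)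
  note Ltend = bounded_linear.tendsto[OF bl]
  have "x1 = x0"
    by (rule LIMSEQ_unique[OF x1 filterlim_compose[OF flow_x_limit_L_limit(1)[OF S eq0] \<tau>]])
  moreover have "L l1 = 0"
    by (rule LIMSEQ_unique[OF Ltend[OF l1] filterlim_compose[OF flow_x_limit_L_limit(2)[OF S eq0] \<tau>]])
  moreover have "L z1 = p - x0"
    by (rule LIMSEQ_unique[OF Ltend[OF z1] filterlim_compose[OF flow_Lz_limit[OF S eq0] \<tau>]])
  moreover have "x0 \<in> K" using eq0 by (simp add: equil_def)
  moreover have "(l1 - G x1) \<bullet> (y - x1) \<le> 0" if "y \<in> K" for y
  proof (rule field_le_epsilon)
    fix e :: real assume "e > 0"
    have "isCont G x1" using cont by (simp add: continuous_on_eq_continuous_at)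
    then have Gx: "(\<lambda>n. G (fst (S (\<tau> n)))) \<longlonglongrightarrow> G x1"
      using x1 by (rule isCont_tendsto_compose)
    have "(\<lambda>n. (fst (snd (S (\<tau> n))) - G (fst (S (\<tau> n)))) \<bullet> (y - fst (S (\<tau> n))))
        \<longlonglongrightarrow> (l1 - G x1) \<bullet> (y - x1)"
      by (intro tendsto_intros x1 l1 Gx)
    moreover have "\<forall>\<^sub>F n in sequentially.
        (fst (snd (S (\<tau> n))) - G (fst (S (\<tau> n)))) \<bullet> (y - fst (S (\<tau> n))) < e"
      by (rule eventually_compose_filterlim[OF flow_variational_limsup[OF S eq0 that \<open>e > 0\<close>] \<tau>])
    then have "\<forall>\<^sub>F n in sequentially.
        (fst (snd (S (\<tau> n))) - G (fst (S (\<tau> n)))) \<bullet> (y - fst (S (\<tau> n))) \<le> e"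
      by (rule eventually_mono) simp
    ultimately show "(l1 - G x1) \<bullet> (y - x1) \<le> 0 + e"
      by (simp add: tendsto_upperbound)
  qed
  ultimately have eq': "equil S'" by (auto simp: equil_def S')
  have "(S \<longlongrightarrow> S') at_top"
  proof (rule tendstoI)
    fix e :: real assume "e > 0"
    then have "\<forall>\<^sub>F n in sequentially. dist (S (\<tau> n)) S' < e" by (rule tendstoD[OF lim])
    then obtain n where n: "dist (S (\<tau> n)) S' < e" unfolding eventually_sequentially by blast
    have "\<tau> n \<ge> 0" by (simp add: \<tau>_def)
    show "\<forall>\<^sub>F t in at_top. dist (S t) S' < e"
      using eventually_ge_at_top[of "\<tau> n"]
    proof eventually_elim
      case (elim t)
      have "norm (S t - S') \<le> norm (S (\<tau> n) - S')"
        using energy_nonincreasing[OF S eq' \<open>\<tau> n \<ge> 0\<close> elim] by (simp add: energy_eq power_mono_iff)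
      then show ?case using n by (simp add: dist_norm)
    qed
  qed
  then show ?thesis using eq' by blast
qed

section \<open>Exponential decay of the unconstrained saddle flow\<close>

text \<open>
  The left-hand side is the derivative of the energy plus \<open>\<epsilon> (b \<bullet> L c - a \<bullet> b)\<close>. Differentiating
  \<open>- a \<bullet> b\<close> produces \<open>- (norm b)\<^sup>2\<close>, differentiating \<open>b \<bullet> L c\<close> produces \<open>- (norm (L c))\<^sup>2\<close>, and the terms
  \<open>a \<bullet> L c\<close> of the two cancel. The remaining products are absorbed by the arithmetic-geometric mean
  inequality, at the cost of multiples of \<open>(norm a)\<^sup>2\<close> and \<open>(norm (L b))\<^sup>2\<close> that the energy
  dissipation pays for when \<open>\<epsilon>\<close> is small.
\<close>

lemma cross_term_dissipation:
  assumes B: "B \<ge> 1" "\<And>v. norm (L v) \<le> B * norm v"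
    and g: "\<mu> * (norm a)\<^sup>2 \<le> a \<bullet> g" "norm g \<le> k * norm a"
    and \<epsilon>: "\<epsilon> > 0" "\<epsilon> * (k\<^sup>2 + 3) \<le> \<mu>" "\<epsilon> * (4 * B) \<le> 1"
  shows "a \<bullet> (b - g) + (b \<bullet> (- L b - L c - a) + c \<bullet> L b)
      + \<epsilon> * ((b \<bullet> L (L b) + (- L b - L c - a) \<bullet> L c) - (a \<bullet> (- L b - L c - a) + (b - g) \<bullet> b))
    \<le> - (\<mu> / 2 * (norm a)\<^sup>2 + \<epsilon> / 2 * (norm b)\<^sup>2 + \<epsilon> / 2 * (norm (L c))\<^sup>2)"
proof -
  define X where "X = g \<bullet> b + a \<bullet> L b - L b \<bullet> L c + (norm (L b))\<^sup>2 + (norm a)\<^sup>2 - (norm b)\<^sup>2 - (norm (L c))\<^sup>2"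
  have "c \<bullet> L b = b \<bullet> L c" by (metis sym inner_commute)
  moreover have "b \<bullet> L (L b) = (norm (L b))\<^sup>2" by (simp add: power2_norm_eq_inner sym)
  ultimately have eq: "a \<bullet> (b - g) + (b \<bullet> (- L b - L c - a) + c \<bullet> L b)
      + \<epsilon> * ((b \<bullet> L (L b) + (- L b - L c - a) \<bullet> L c) - (a \<bullet> (- L b - L c - a) + (b - g) \<bullet> b))
    = - (a \<bullet> g) - b \<bullet> L b + \<epsilon> * X"
    by (simp add: X_def power2_norm_eq_inner inner_diff_left inner_diff_right inner_commute[of b a])
  have amgm: "u * v \<le> (u\<^sup>2 + v\<^sup>2) / 2" for u v :: real
    using sum_squares_bound[of u v] by simp
  have "g \<bullet> b \<le> norm g * norm b" by (rule norm_cauchy_schwarz)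
  also have "\<dots> \<le> (k * norm a) * norm b" by (intro mult_right_mono g norm_ge_zero)
  also have "\<dots> \<le> ((k * norm a)\<^sup>2 + (norm b)\<^sup>2) / 2" by (rule amgm)
  finally have 1: "g \<bullet> b \<le> (k\<^sup>2 * (norm a)\<^sup>2 + (norm b)\<^sup>2) / 2" by (simp add: power_mult_distrib)
  have 2: "a \<bullet> L b \<le> ((norm a)\<^sup>2 + (norm (L b))\<^sup>2) / 2"
    using norm_cauchy_schwarz amgm by (rule order_trans)
  have "- (L b \<bullet> L c) \<le> norm (L b) * norm (L c)"
    using norm_cauchy_schwarz[of "- L b" "L c"] by simp
  also have "\<dots> \<le> ((norm (L b))\<^sup>2 + (norm (L c))\<^sup>2) / 2" by (rule amgm)
  finally have 3: "- (L b \<bullet> L c) \<le> ((norm (L b))\<^sup>2 + (norm (L c))\<^sup>2) / 2" .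
  have "(norm (L b))\<^sup>2 \<le> B * (b \<bullet> L b)"
    using B(1) by (intro psd_norm_bound lin sym psd B(2)) auto
  then have "\<epsilon> * 4 * (norm (L b))\<^sup>2 \<le> \<epsilon> * 4 * (B * (b \<bullet> L b))"
    using \<epsilon>(1) by (intro mult_left_mono) auto
  also have "\<dots> = \<epsilon> * (4 * B) * (b \<bullet> L b)" by simp
  also have "\<dots> \<le> 1 * (b \<bullet> L b)" using \<epsilon>(3) psd by (intro mult_right_mono) auto
  finally have 4: "\<epsilon> * 4 * (norm (L b))\<^sup>2 \<le> b \<bullet> L b" by simp
  have 5: "\<epsilon> * (k\<^sup>2 + 3) * (norm a)\<^sup>2 \<le> \<mu> * (norm a)\<^sup>2"
    using \<epsilon>(2) by (intro mult_right_mono) auto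
  have "X \<le> (k\<^sup>2 + 3) / 2 * (norm a)\<^sup>2 - (norm b)\<^sup>2 / 2 - (norm (L c))\<^sup>2 / 2 + 2 * (norm (L b))\<^sup>2"
    using 1 2 3 unfolding X_def by (simp add: add_divide_distrib distrib_right)
  then have "\<epsilon> * X \<le> \<epsilon> * ((k\<^sup>2 + 3) / 2 * (norm a)\<^sup>2 - (norm b)\<^sup>2 / 2 - (norm (L c))\<^sup>2 / 2 + 2 * (norm (L b))\<^sup>2)"
    using \<epsilon>(1) by (intro mult_left_mono) auto
  also have "\<dots> = \<epsilon> * (k\<^sup>2 + 3) * (norm a)\<^sup>2 / 2 - \<epsilon> / 2 * (norm b)\<^sup>2 - \<epsilon> / 2 * (norm (L c))\<^sup>2
      + \<epsilon> * 4 * (norm (L b))\<^sup>2 / 2"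
    by (simp add: algebra_simps)
  finally show ?thesis
    unfolding eq using g(1) 4 5 psd[of b] by linarith
qed

text \<open>
  For \<open>n\<close> in the kernel of the symmetric map \<open>L\<close>, the derivative \<open>L l \<bullet> n\<close> of \<open>z \<bullet> n\<close> vanishes. For the
  Laplacian this is conservation of the sum of the \<open>z\<close> components.
\<close>

lemma flow_kernel_component:
  assumes S: "flow S" and lim: "(S \<longlongrightarrow> (x1, l1, z1)) at_top" and n: "L n = 0" and "t \<ge> 0"
  shows "(snd (snd (S t)) - z1) \<bullet> n = 0"
proof -
  let ?h = "\<lambda>n t. snd (snd (S t)) \<bullet> n"
  have le: "?h n t \<le> ?h n s" if n: "L n = 0" and st: "0 \<le> s" "s \<le> t" for n s t
  proof (rule nonincreasing_halfline[of "?h n", OF _ _ st])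
    show "abs_continuous_on 0 T (?h n)" if "T \<ge> 0" for T
      by (intro abs_continuous_on_inner abs_continuous_on_const
          abs_continuous_on_bounded_linear[OF bounded_linear_snd] flow_abs_continuous[OF S that])
    show "AE t in lebesgue. t \<ge> 0 \<longrightarrow> (\<exists>D\<le>0. (?h n has_real_derivative D) (at t within {0..}))"
    proof (rule flow_AE_D[OF S])
      fix t v assume d: "(S has_vector_derivative velocity (S t) v) (at t within {0..})"
      have "((\<lambda>t. snd (snd (S t))) has_vector_derivative L (fst (snd (S t)))) (at t within {0..})"
        using bounded_linear.has_vector_derivative[OF bounded_linear_compose[OF bounded_linear_snd bounded_linear_snd] d]
        by (simp add: velocity_def case_prod_unfold)
      from has_real_derivative_inner[OF this has_vector_derivative_const[of n]]
      have "(?h n has_real_derivative L (fst (snd (S t))) \<bullet> n) (at t within {0..})" by simp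
      then show "\<exists>D\<le>0. (?h n has_real_derivative D) (at t within {0..})"
        using n by (intro exI[of _ "L (fst (snd (S t))) \<bullet> n"]) (simp add: sym)
    qed
  qed
  have const: "?h n s = ?h n t" if "s \<ge> t" for s
  proof -
    have "L (- n) = 0" using n by (simp add: linear_neg[OF lin])
    then have "?h (- n) s \<le> ?h (- n) t" using le[of "- n" t s] that \<open>t \<ge> 0\<close> by simp
    then show ?thesis using le[OF n \<open>t \<ge> 0\<close> that] by simp
  qed
  have "(?h n \<longlongrightarrow> z1 \<bullet> n) at_top"
    using tendsto_inner[OF tendsto_snd[OF tendsto_snd[OF lim]] tendsto_const[of n]] by simp
  moreover have "(?h n \<longlongrightarrow> ?h n t) at_top"
    by (rule tendsto_eventually, rule eventually_mono[OF eventually_ge_at_top[of t]]) (rule const)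
  ultimately have "z1 \<bullet> n = ?h n t" by (intro tendsto_unique[of at_top]) auto
  then show ?thesis by (simp add: inner_diff_left)
qed

text \<open>
  On the orthogonal complement of its kernel, \<open>L\<close> is injective and hence bounded below.
\<close>

lemma L_bounded_below:
  obtains \<sigma> where "\<sigma> > 0" "\<And>u. (\<And>n. L n = 0 \<Longrightarrow> u \<bullet> n = 0) \<Longrightarrow> \<sigma> * norm u \<le> norm (L u)"
proof -
  let ?M = "{u. \<forall>n. L n = 0 \<longrightarrow> u \<bullet> n = 0}"
  have sub: "subspace ?M" by (auto simp: subspace_def inner_add_left)
  have "\<exists>e>0. \<forall>u\<in>?M. norm (L u) \<ge> e * norm u"
  proof (rule injective_imp_isometric[OF closed_subspace[OF sub] sub])
    show "bounded_linear L" using lin by (simp add: linear_conv_bounded_linear)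
    show "\<forall>u\<in>?M. L u = 0 \<longrightarrow> u = 0" by (metis (mono_tags, lifting) inner_eq_zero_iff mem_Collect_eq)
  qed
  then show ?thesis using that by auto
qed

text \<open>
  The energy alone does not dissipate in \<open>b = l - l0\<close> and \<open>c = z - z0\<close>; the derivative of the cross terms
  does.
\<close>

definition lyapunov :: "real \<Rightarrow> 'a \<times> 'a \<times> 'a \<Rightarrow> 'a \<times> 'a \<times> 'a \<Rightarrow> real" where
  "lyapunov \<epsilon> = (\<lambda>(x0, l0, z0) (x, l, z). energy (x0, l0, z0) (x, l, z)
     + \<epsilon> * ((l - l0) \<bullet> L (z - z0) - (x - x0) \<bullet> (l - l0)))"

text \<open>
  For small \<open>\<epsilon>\<close> the cross terms do not spoil the equivalence of the energy with the squared distance.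
\<close>

lemma lyapunov_bounds:
  assumes B: "B \<ge> 1" "\<And>v. norm (L v) \<le> B * norm v" and \<epsilon>: "\<epsilon> > 0" "\<epsilon> * (4 * B) \<le> 1"
  shows "(norm (s - s0))\<^sup>2 / 4 \<le> lyapunov \<epsilon> s0 s" "lyapunov \<epsilon> s0 s \<le> (norm (s - s0))\<^sup>2"
proof -
  obtain x l z x0 l0 z0 where s: "s = (x, l, z)" "s0 = (x0, l0, z0)" by (cases s, cases s0)
  define a b c where abc: "a = x - x0" "b = l - l0" "c = z - z0"
  define N where "N = (norm (s - s0))\<^sup>2"
  have N: "N = (norm a)\<^sup>2 + (norm b)\<^sup>2 + (norm c)\<^sup>2"
    by (simp add: N_def s abc power2_norm_eq_inner inner_prod_def)
  have amgm: "u * v \<le> (u\<^sup>2 + v\<^sup>2) / 2" for u v :: real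
    using sum_squares_bound[of u v] by simp
  have "\<bar>b \<bullet> L c - a \<bullet> b\<bar> \<le> \<bar>b \<bullet> L c\<bar> + \<bar>a \<bullet> b\<bar>" by simp
  also have "\<dots> \<le> norm b * norm (L c) + norm a * norm b" by (intro add_mono Cauchy_Schwarz_ineq2)
  also have "\<dots> \<le> norm b * (B * norm c) + norm a * norm b"
    by (intro add_mono mult_left_mono B order_refl norm_ge_zero)
  also have "\<dots> = B * (norm b * norm c) + norm a * norm b" by simp
  also have "\<dots> \<le> B * (N / 2) + N / 2"
  proof (intro add_mono mult_left_mono)
    show "norm b * norm c \<le> N / 2" "norm a * norm b \<le> N / 2"
      using amgm[of "norm b" "norm c"] amgm[of "norm a" "norm b"] unfolding N
      by (smt (verit) divide_right_mono zero_le_power2)+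
  qed (use B in auto)
  also have "\<dots> \<le> B * N"
    using mult_right_mono[OF B(1), of "N / 2"] by (simp add: N_def)
  finally have "\<epsilon> * \<bar>b \<bullet> L c - a \<bullet> b\<bar> \<le> \<epsilon> * (B * N)" using \<epsilon>(1) by (intro mult_left_mono) auto
  also have "\<dots> = \<epsilon> * (4 * B) * N / 4" by simp
  also have "\<dots> \<le> 1 * N / 4" using \<epsilon>(2) by (intro divide_right_mono mult_right_mono) (auto simp: N_def)
  finally have "\<bar>\<epsilon> * (b \<bullet> L c - a \<bullet> b)\<bar> \<le> N / 4" using \<epsilon>(1) by (simp add: abs_mult)
  moreover have "lyapunov \<epsilon> s0 s = N / 2 + \<epsilon> * (b \<bullet> L c - a \<bullet> b)"
    by (simp add: lyapunov_def s abc energy_eq N_def)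
  moreover have "N \<ge> 0" by (simp add: N_def)
  ultimately show "(norm (s - s0))\<^sup>2 / 4 \<le> lyapunov \<epsilon> s0 s" "lyapunov \<epsilon> s0 s \<le> (norm (s - s0))\<^sup>2"
    unfolding N_def[symmetric] by linarith+
qed

lemma lyapunov_abs_continuous:
  assumes "flow S" "T \<ge> 0"
  shows "abs_continuous_on 0 T (\<lambda>t. lyapunov \<epsilon> (x0, l0, z0) (S t))"
proof -
  have bl: "bounded_linear L" using lin by (simp add: linear_conv_bounded_linear)
  show ?thesis
    unfolding lyapunov_def case_prod_unfold prod.collapse fst_conv snd_conv
    by (intro abs_continuous_on_add energy_abs_continuous assms abs_continuous_on_mult abs_continuous_on_const
        abs_continuous_on_diff abs_continuous_on_inner abs_continuous_on_bounded_linear[OF bl]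
        abs_continuous_on_bounded_linear[OF bounded_linear_fst]
        abs_continuous_on_bounded_linear[OF bounded_linear_snd] flow_abs_continuous)
qed

lemma lyapunov_deriv:
  assumes d: "(S has_vector_derivative (x', l', z')) (at t within A)" and S: "S t = (x, l, z)"
  shows "((\<lambda>t. lyapunov \<epsilon> (x0, l0, z0) (S t)) has_real_derivative
      (x - x0) \<bullet> x' + ((l - l0) \<bullet> l' + (z - z0) \<bullet> z')
      + \<epsilon> * (((l - l0) \<bullet> L z' + l' \<bullet> L (z - z0)) - ((x - x0) \<bullet> l' + x' \<bullet> (l - l0)))) (at t within A)"
proof -
  have bl: "bounded_linear L" using lin by (simp add: linear_conv_bounded_linear)
  have "((\<lambda>t. fst (S t)) has_vector_derivative x') (at t within A)"
    using bounded_linear.has_vector_derivative[OF bounded_linear_fst d] by simp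
  then have dx: "((\<lambda>t. fst (S t) - x0) has_vector_derivative x') (at t within A)"
    by (auto intro!: derivative_eq_intros)
  have "((\<lambda>t. fst (snd (S t))) has_vector_derivative l') (at t within A)"
    using bounded_linear.has_vector_derivative[OF bounded_linear_compose[OF bounded_linear_fst bounded_linear_snd] d] by simp
  then have dl: "((\<lambda>t. fst (snd (S t)) - l0) has_vector_derivative l') (at t within A)"
    by (auto intro!: derivative_eq_intros)
  have "((\<lambda>t. snd (snd (S t))) has_vector_derivative z') (at t within A)"
    using bounded_linear.has_vector_derivative[OF bounded_linear_compose[OF bounded_linear_snd bounded_linear_snd] d] by simp
  then have dz: "((\<lambda>t. snd (snd (S t)) - z0) has_vector_derivative z') (at t within A)"
    by (auto intro!: derivative_eq_intros)
  note dLz = bounded_linear.has_vector_derivative[OF bl dz]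
  have "((\<lambda>t. energy (x0, l0, z0) (S t) + \<epsilon> * ((fst (snd (S t)) - l0) \<bullet> L (snd (snd (S t)) - z0)
        - (fst (S t) - x0) \<bullet> (fst (snd (S t)) - l0)))
     has_real_derivative (S t - (x0, l0, z0)) \<bullet> (x', l', z') + \<epsilon> *
       (((fst (snd (S t)) - l0) \<bullet> L z' + l' \<bullet> L (snd (snd (S t)) - z0))
       - ((fst (S t) - x0) \<bullet> l' + x' \<bullet> (fst (snd (S t)) - l0)))) (at t within A)"
    by (intro DERIV_add DERIV_cmult DERIV_diff energy_deriv[OF d] has_real_derivative_inner dx dl dLz)
  then show ?thesis by (simp add: lyapunov_def case_prod_unfold S inner_prod_def)
qed

text \<open>
  When \<open>K\<close> is the whole space, the variational inequalities become the equations \<open>v = l - G x\<close> and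
  \<open>l0 = G x0\<close>, so the derivative of the Lyapunov function is exactly the expression estimated
  above. The constants depend only on \<open>\<mu>\<close>, \<open>k\<close> and \<open>L\<close>.
\<close>

theorem flow_converges_exponentially:
  assumes K: "K = UNIV" and lip: "\<And>u v. norm (G u - G v) \<le> k * norm (u - v)"
    and ex: "equil S0"
  shows "\<exists>C>0. \<exists>\<kappa>>0. \<forall>S. flow S \<longrightarrow> (\<exists>S'. equil S' \<and> (S \<longlongrightarrow> S') at_top \<and>
     (\<forall>t\<ge>0. norm (S t - S') \<le> C * norm (S 0 - S') * exp (- \<kappa> * t)))"
proof -
  obtain B where B: "B \<ge> 1" "\<And>v. norm (L v) \<le> B * norm v" using L_bounded by blast
  obtain \<sigma> where \<sigma>: "\<sigma> > 0" "\<And>u. (\<And>n. L n = 0 \<Longrightarrow> u \<bullet> n = 0) \<Longrightarrow> \<sigma> * norm u \<le> norm (L u)"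
    using L_bounded_below by blast
  \<comment> \<open>The bounds on \<open>\<epsilon>\<close> are those of the dissipation estimate; the second also gives the equivalence of norms.\<close>
  define \<epsilon> where "\<epsilon> = min (\<mu> / (k\<^sup>2 + 3)) (1 / (4 * B))"
  have k3: "k\<^sup>2 + 3 > 0" by (simp add: add_nonneg_pos)
  have \<epsilon>: "\<epsilon> > 0" using mu k3 B(1) by (simp add: \<epsilon>_def)
  have "\<epsilon> \<le> \<mu> / (k\<^sup>2 + 3)" "\<epsilon> \<le> 1 / (4 * B)" by (simp_all add: \<epsilon>_def)
  then have \<epsilon>_le: "\<epsilon> * (k\<^sup>2 + 3) \<le> \<mu>" "\<epsilon> * (4 * B) \<le> 1"
    using k3 B(1) by (simp_all add: pos_le_divide_eq)
  define r where "r = min (\<mu> / 2) (min (\<epsilon> / 2) (\<epsilon> / 2 * \<sigma>\<^sup>2))"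
  have r: "r > 0" "r \<le> \<mu> / 2" "r \<le> \<epsilon> / 2" "r \<le> \<epsilon> / 2 * \<sigma>\<^sup>2"
    using mu \<epsilon> \<sigma>(1) by (simp_all add: r_def)
  have zero: "u = 0" if "\<And>y. u \<bullet> (y - x) \<le> 0" for u x :: 'a
  proof -
    have "u \<bullet> u \<le> 0" using that[of "x + u"] by simp
    then show ?thesis by (meson inner_gt_zero_iff not_less)
  qed
  have main: "\<exists>S'. equil S' \<and> (S \<longlongrightarrow> S') at_top \<and>
      (\<forall>t\<ge>0. norm (S t - S') \<le> 2 * norm (S 0 - S') * exp (- (r / 2) * t))" if S: "flow S" for S
  proof -
    obtain S' where eq: "equil S'" and lim: "(S \<longlongrightarrow> S') at_top"
      using flow_converges[OF S ex] by blast
    obtain x0 l0 z0 where S': "S' = (x0, l0, z0)" by (cases S')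
    have "\<forall>y\<in>K. (l0 - G x0) \<bullet> (y - x0) \<le> 0" using eq by (simp add: S' equil_def)
    then have "l0 - G x0 = 0" unfolding K by (intro zero[of _ x0]) simp
    then have Gx0: "G x0 = l0" and l0: "L l0 = 0" and z0: "L z0 = p - x0"
      using eq by (auto simp: S' equil_def)
    let ?W = "\<lambda>t. lyapunov \<epsilon> S' (S t)"
    have decay: "?W t \<le> ?W 0 * exp (- r * t)" if "t \<ge> 0" for t
    proof (rule exponential_decay[OF _ _ that])
      show "abs_continuous_on 0 T ?W" if "T \<ge> 0" for T
        unfolding S' by (rule lyapunov_abs_continuous[OF S that])
      show "AE t in lebesgue. t \<ge> 0 \<longrightarrow> (\<exists>D. D \<le> - r * ?W t \<and> (?W has_real_derivative D) (at t within {0..}))"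
      proof (rule flow_AE_D[OF S])
        fix t v assume t: "t \<ge> 0" and adm: "admissible (S t) v"
          and d: "(S has_vector_derivative velocity (S t) v) (at t within {0..})"
        obtain x l z where St: "S t = (x, l, z)" by (cases "S t")
        define a b c g where abc: "a = x - x0" "b = l - l0" "c = z - z0" "g = G x - G x0"
        have "\<forall>y\<in>K. (l - G x - v) \<bullet> (y - x) \<le> 0" using adm by (simp add: St admissible_def)
        then have "l - G x - v = 0" unfolding K by (intro zero[of _ x]) simp
        then have v: "v = b - g" using Gx0 by (simp add: abc)
        have Ll: "L l = L b" using l0 by (simp add: abc linear_diff[OF lin])
        have Lz: "L z = L c + (p - x0)" using z0 by (simp add: abc linear_diff[OF lin])
        have l': "- L l - L z + (p - x) = - L b - L c - a" by (simp add: Ll Lz abc(1))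
        have vel: "velocity (S t) v = (b - g, - L b - L c - a, L b)"
          unfolding St velocity_def prod.case l' v by (simp only: Ll)
        define DW where "DW = a \<bullet> (b - g) + (b \<bullet> (- L b - L c - a) + c \<bullet> L b)
          + \<epsilon> * ((b \<bullet> L (L b) + (- L b - L c - a) \<bullet> L c) - (a \<bullet> (- L b - L c - a) + (b - g) \<bullet> b))"
        have D: "(?W has_real_derivative DW) (at t within {0..})"
          unfolding DW_def S' using lyapunov_deriv[OF d[unfolded vel] St, of \<epsilon> x0 l0 z0]
          by (simp only: abc(1,2,3)[symmetric])
        have "\<sigma> * norm c \<le> norm (L c)"
          using flow_kernel_component[OF S lim[unfolded S'] _ t] by (intro \<sigma>(2)) (simp add: St abc)
        then have "\<sigma>\<^sup>2 * (norm c)\<^sup>2 \<le> (norm (L c))\<^sup>2"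
          using \<sigma>(1) by (simp add: power_mult_distrib[symmetric] power_mono)
        then have "\<epsilon> / 2 * (\<sigma>\<^sup>2 * (norm c)\<^sup>2) \<le> \<epsilon> / 2 * (norm (L c))\<^sup>2"
          using \<epsilon> by (intro mult_left_mono) auto
        moreover have "r * (norm c)\<^sup>2 \<le> \<epsilon> / 2 * \<sigma>\<^sup>2 * (norm c)\<^sup>2"
          "r * (norm a)\<^sup>2 \<le> \<mu> / 2 * (norm a)\<^sup>2" "r * (norm b)\<^sup>2 \<le> \<epsilon> / 2 * (norm b)\<^sup>2"
          using r by (intro mult_right_mono; simp)+
        moreover have "(norm (S t - S'))\<^sup>2 = (norm a)\<^sup>2 + (norm b)\<^sup>2 + (norm c)\<^sup>2"
          by (simp add: St S' abc power2_norm_eq_inner inner_prod_def)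
        ultimately have "r * (norm (S t - S'))\<^sup>2
            \<le> \<mu> / 2 * (norm a)\<^sup>2 + \<epsilon> / 2 * (norm b)\<^sup>2 + \<epsilon> / 2 * (norm (L c))\<^sup>2"
          by (simp add: distrib_left mult.assoc)
        moreover have "r * ?W t \<le> r * (norm (S t - S'))\<^sup>2"
          using r(1) lyapunov_bounds(2)[OF B \<epsilon> \<epsilon>_le(2)] by (intro mult_left_mono) auto
        moreover have "\<mu> * (norm a)\<^sup>2 \<le> a \<bullet> g" "norm g \<le> k * norm a"
          using mono[of x x0] lip[of x x0] by (simp_all add: abc)
        then have "DW \<le> - (\<mu> / 2 * (norm a)\<^sup>2 + \<epsilon> / 2 * (norm b)\<^sup>2 + \<epsilon> / 2 * (norm (L c))\<^sup>2)"
          unfolding DW_def by (intro cross_term_dissipation[OF B _ _ \<epsilon> \<epsilon>_le])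
        ultimately have "DW \<le> - r * ?W t" by simp
        with D show "\<exists>D. D \<le> - r * ?W t \<and> (?W has_real_derivative D) (at t within {0..})"
          by blast
      qed
    qed
    have "norm (S t - S') \<le> 2 * norm (S 0 - S') * exp (- (r / 2) * t)" if "t \<ge> 0" for t
    proof (rule power2_le_imp_le)
      have "(norm (S t - S'))\<^sup>2 \<le> 4 * ?W t"
        using lyapunov_bounds(1)[OF B \<epsilon> \<epsilon>_le(2), of "S t" S'] by simp
      also have "\<dots> \<le> 4 * (?W 0 * exp (- r * t))" using decay[OF that] by simp
      also have "\<dots> \<le> 4 * ((norm (S 0 - S'))\<^sup>2 * exp (- r * t))"
        using lyapunov_bounds(2)[OF B \<epsilon> \<epsilon>_le(2), of S' "S 0"] by (intro mult_left_mono mult_right_mono) auto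
      also have "exp (- r * t) = (exp (- (r / 2) * t))\<^sup>2"
        by (simp add: power2_eq_square exp_add[symmetric])
      finally show "(norm (S t - S'))\<^sup>2 \<le> (2 * norm (S 0 - S') * exp (- (r / 2) * t))\<^sup>2"
        by (simp add: power_mult_distrib)
    qed simp
    then show ?thesis using eq lim by blast
  qed
  show ?thesis
    by (rule exI[of _ 2], intro conjI, simp, rule exI[of _ "r / 2"]) (use r(1) main in auto)
qed

end

section \<open>The graph Laplacian\<close>

definition laplacian :: "('n::finite \<times> 'n) set \<Rightarrow> 'a::euclidean_space ^ 'n \<Rightarrow> 'a ^ 'n" where
  "laplacian E u = (\<chi> i. \<Sum>j\<in>nbrs E i. u $ i - u $ j)"

lemma linear_laplacian: "linear (laplacian E)"
  by (rule linearI) (simp_all add: laplacian_def vec_eq_iff sum.distrib[symmetric] scaleR_sum_right algebra_simps)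

text \<open>
  The sum over all ordered edges counts every undirected edge twice, and exchanging the
  endpoints of an edge leaves the edge set invariant.
\<close>

lemma laplacian_inner:
  assumes "sym E"
  shows "laplacian E u \<bullet> v = (\<Sum>(i, j)\<in>E. (u $ i - u $ j) \<bullet> (v $ i - v $ j)) / 2"
proof -
  have E: "(SIGMA i:UNIV. nbrs E i) = E" using assms by (auto simp: nbrs_def sym_def)
  have 1: "laplacian E u \<bullet> v = (\<Sum>(i, j)\<in>E. (u $ i - u $ j) \<bullet> v $ i)"
    unfolding laplacian_def inner_vec_def
    by (simp add: inner_sum_left sum.Sigma E)
  also have "\<dots> = (\<Sum>(i, j)\<in>E. (u $ j - u $ i) \<bullet> v $ j)"
  proof (rule sum.reindex_bij_witness[of _ prod.swap prod.swap])
    show "prod.swap e \<in> E" if "e \<in> E" for e using that assms by (cases e) (auto simp: sym_def)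
    show "prod.swap e \<in> E" if "e \<in> E" for e using that assms by (cases e) (auto simp: sym_def)
  qed auto
  finally have 2: "laplacian E u \<bullet> v = (\<Sum>(i, j)\<in>E. (u $ j - u $ i) \<bullet> v $ j)" .
  have "2 * (laplacian E u \<bullet> v) = (\<Sum>(i, j)\<in>E. (u $ i - u $ j) \<bullet> v $ i) + (\<Sum>(i, j)\<in>E. (u $ j - u $ i) \<bullet> v $ j)"
    using 1 2 by simp
  also have "\<dots> = (\<Sum>(i, j)\<in>E. (u $ i - u $ j) \<bullet> (v $ i - v $ j))"
    by (simp add: sum.distrib[symmetric] case_prod_unfold inner_diff_left inner_diff_right)
      (simp add: algebra_simps)
  finally show ?thesis by simp
qed

lemma laplacian_symmetric:
  assumes "sym E"
  shows "laplacian E u \<bullet> v = u \<bullet> laplacian E v"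
proof -
  have "laplacian E u \<bullet> v = laplacian E v \<bullet> u"
    unfolding laplacian_inner[OF assms] by (simp only: inner_commute)
  then show ?thesis by (simp only: inner_commute)
qed

lemma laplacian_psd: "sym E \<Longrightarrow> 0 \<le> u \<bullet> laplacian E u"
  by (subst inner_commute) (auto simp: laplacian_inner intro!: sum_nonneg)

lemma laplacian_kernel:
  assumes "sym E" "connected_graph E" "laplacian E u = 0"
  shows "u $ i = u $ j"
proof -
  have "(\<Sum>(i, j)\<in>E. (u $ i - u $ j) \<bullet> (u $ i - u $ j)) = 0"
    using laplacian_inner[OF assms(1), of u u] assms(3) by simp
  then have "\<forall>e\<in>E. (case e of (i, j) \<Rightarrow> (u $ i - u $ j) \<bullet> (u $ i - u $ j)) = 0"
    by (subst (asm) sum_nonneg_eq_0_iff) auto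
  then have edge: "u $ i = u $ j" if "(i, j) \<in> E" for i j using that by auto
  have "(i, j) \<in> E\<^sup>*" using assms(2) by (simp add: connected_graph_def)
  then show ?thesis by induction (auto dest: edge)
qed

lemma laplacian_const: "laplacian E (\<chi> i. c) = 0"
  by (simp add: laplacian_def vec_eq_iff)

text \<open>
  The orthogonal complement of the range of a symmetric map is its kernel, which consists of the
  constant families; \<open>w\<close> is orthogonal to those.
\<close>

lemma laplacian_range:
  fixes w :: "'a::euclidean_space ^ 'n::finite"
  assumes E: "sym E" "connected_graph E" and w: "(\<Sum>i\<in>UNIV. w $ i) = 0"
  shows "\<exists>z. laplacian E z = w"
proof -
  let ?R = "range (laplacian E :: 'a ^ 'n \<Rightarrow> 'a ^ 'n)"
  have R: "span ?R = ?R"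
    using linear_subspace_image[OF linear_laplacian subspace_UNIV] by (intro span_eq_iff[THEN iffD2])
  obtain y n where y: "y \<in> ?R" and orth: "\<And>r. r \<in> ?R \<Longrightarrow> orthogonal n r" and eq: "w = y + n"
    using orthogonal_subspace_decomp_exists[of ?R w] unfolding R by metis
  have "laplacian E n \<bullet> laplacian E n = n \<bullet> laplacian E (laplacian E n)"
    using E(1) by (simp add: laplacian_symmetric)
  also have "\<dots> = 0" using orth[of "laplacian E (laplacian E n)"] by (simp add: orthogonal_def)
  finally have "laplacian E n = 0" by simp
  then have n: "n $ i = n $ j" for i j by (rule laplacian_kernel[OF E])
  fix i0 :: 'n
  have "n \<bullet> w = (\<Sum>i\<in>UNIV. n $ i0 \<bullet> w $ i)"
    unfolding inner_vec_def using n by (intro sum.cong refl) metis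
  also have "\<dots> = n $ i0 \<bullet> (\<Sum>i\<in>UNIV. w $ i)" by (rule inner_sum_right[symmetric])
  finally have "n \<bullet> w = 0" using w by simp
  moreover have "n \<bullet> y = 0" using orth[OF y] by (simp add: orthogonal_def)
  ultimately have "n = 0" by (simp add: eq inner_add_right)
  then show ?thesis using y eq by auto
qed

section \<open>A common multiplier at an optimal allocation\<close>

text \<open>
  The Riesz representative of the derivative is its adjoint applied to \<open>1\<close>.
\<close>

lemma GDERIV_grad:
  fixes f :: "'a::euclidean_space \<Rightarrow> real"
  assumes "f differentiable (at x)"
  shows "GDERIV f x :> grad f x"
proof -
  obtain f' where f': "(f has_derivative f') (at x)" using assms by (auto simp: differentiable_def)
  then have "linear f'" by (simp add: bounded_linear.linear has_derivative_bounded_linear)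
  then have "f' h = h \<bullet> adjoint f' 1" for h by (simp add: adjoint_works)
  then have "f' = (\<lambda>h. h \<bullet> adjoint f' 1)" by (rule ext)
  then have ex: "GDERIV f x :> adjoint f' 1" using f' unfolding gderiv_def by simp
  have "D = adjoint f' 1" if "GDERIV f x :> D" for D
  proof -
    have "(\<lambda>h. h \<bullet> D) = (\<lambda>h. h \<bullet> adjoint f' 1)"
      using that ex unfolding gderiv_def by (rule has_derivative_unique)
    then have "h \<bullet> D = h \<bullet> adjoint f' 1" for h by (rule fun_cong)
    then show ?thesis by (metis vector_eq_rdot inner_commute)
  qed
  then show ?thesis unfolding grad_def using ex by (rule theI[rotated])
qed

text \<open>
  The objective along the feasible segment from \<open>X\<close> to \<open>y\<close> cannot start by decreasing.
\<close>

lemma optimal_first_order: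
  fixes f :: "'n::finite \<Rightarrow> 'a::euclidean_space \<Rightarrow> real"
  assumes diff: "\<And>i x. f i differentiable (at x)" and conv: "\<And>i. convex (\<Omega> i)"
    and opt: "optimal_solution f \<Omega> d X" and y: "feasible \<Omega> d y"
  shows "0 \<le> (\<Sum>i\<in>UNIV. grad (f i) (X i) \<bullet> (y i - X i))"
proof (rule ccontr)
  let ?g = "\<lambda>t. \<Sum>i\<in>UNIV. f i (X i + t *\<^sub>R (y i - X i))"
  assume neg: "\<not> ?thesis"
  have X: "feasible \<Omega> d X" using opt by (simp add: optimal_solution_def)
  have "((\<lambda>t. f i (X i + t *\<^sub>R (y i - X i))) has_real_derivative grad (f i) (X i) \<bullet> (y i - X i)) (at 0)" for i
  proof -
    have 1: "((\<lambda>t. X i + t *\<^sub>R (y i - X i)) has_derivative (\<lambda>t. t *\<^sub>R (y i - X i))) (at 0)"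
      by (auto intro!: derivative_eq_intros)
    have "(f i has_derivative (\<lambda>h. h \<bullet> grad (f i) (X i))) (at (X i + 0 *\<^sub>R (y i - X i)))"
      using GDERIV_grad[OF diff] by (simp add: gderiv_def)
    from diff_chain_at[OF 1 this]
    have "((\<lambda>t. f i (X i + t *\<^sub>R (y i - X i))) has_derivative (\<lambda>t. (t *\<^sub>R (y i - X i)) \<bullet> grad (f i) (X i))) (at 0)"
      by (simp add: o_def)
    then show ?thesis
      by (rule has_derivative_imp_has_field_derivative) (simp add: inner_commute)
  qed
  then have "(?g has_real_derivative (\<Sum>i\<in>UNIV. grad (f i) (X i) \<bullet> (y i - X i))) (at 0)"
    by (intro DERIV_sum)
  from DERIV_neg_dec_right[OF this] neg obtain e where e: "e > 0"
    "\<And>h. 0 < h \<Longrightarrow> h < e \<Longrightarrow> ?g (0 + h) < ?g 0" by (auto simp: not_le)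
  define h where "h = min (e / 2) (1 / 2)"
  have h: "0 < h" "h < e" "h \<le> 1" using e(1) by (auto simp: h_def)
  have "feasible \<Omega> d (\<lambda>i. X i + h *\<^sub>R (y i - X i))"
    unfolding feasible_def
  proof (intro conjI allI)
    have "(\<Sum>i\<in>UNIV. X i + h *\<^sub>R (y i - X i)) = (\<Sum>i\<in>UNIV. X i) + h *\<^sub>R ((\<Sum>i\<in>UNIV. y i) - (\<Sum>i\<in>UNIV. X i))"
      by (simp add: sum.distrib sum_subtractf scaleR_sum_right[symmetric])
    then show "(\<Sum>i\<in>UNIV. X i + h *\<^sub>R (y i - X i)) = (\<Sum>i\<in>UNIV. d i)"
      using X y by (simp add: feasible_def)
    fix i
    have "X i + h *\<^sub>R (y i - X i) = (1 - h) *\<^sub>R X i + h *\<^sub>R y i" by (simp add: algebra_simps)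
    then show "X i + h *\<^sub>R (y i - X i) \<in> \<Omega> i"
      using X y h convexD[OF conv[of i], of "X i" "y i" "1 - h" h] by (simp add: feasible_def)
  qed
  then have "?g 0 \<le> ?g h" using opt by (simp add: optimal_solution_def)
  then show False using e(2)[OF h(1,2)] by simp
qed

text \<open>
  Separate the convex set of all pairs (resource imbalance, first-order change of the objective)
  of feasible displacements from the pairs with zero imbalance and negative change. The separating
  functional \<open>(p, q)\<close> has \<open>q > 0\<close>: if \<open>q\<close> vanished, moving one coordinate of a Slater point against \<open>p\<close>
  would contradict the separation. Then \<open>- p / q\<close> is the multiplier.
\<close>

lemma optimal_common_multiplier:
  fixes f :: "'n::finite \<Rightarrow> 'a::euclidean_space \<Rightarrow> real"
  assumes diff: "\<And>i x. f i differentiable (at x)" and conv: "\<And>i. convex (\<Omega> i)"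
    and opt: "optimal_solution f \<Omega> d X" and slater: "slater \<Omega> d"
  obtains l where "\<And>i y. y \<in> \<Omega> i \<Longrightarrow> (l - grad (f i) (X i)) \<bullet> (y - X i) \<le> 0"
proof -
  let ?g = "\<lambda>i. grad (f i) (X i)"
  have X: "\<And>i. X i \<in> \<Omega> i" "(\<Sum>i\<in>UNIV. X i) = (\<Sum>i\<in>UNIV. d i)"
    using opt by (auto simp: optimal_solution_def feasible_def)
  define V where "V = {v :: 'a ^ 'n. \<forall>i. X i + v $ i \<in> \<Omega> i}"
  define H where "H v = (\<Sum>i\<in>UNIV. v $ i, \<Sum>i\<in>UNIV. ?g i \<bullet> v $ i)" for v :: "'a ^ 'n"
  have "linear H"
    by (rule linearI) (simp_all add: H_def sum.distrib scaleR_sum_right sum_distrib_left inner_add_right)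
  have "convex V"
  proof (rule convexI)
    fix u v :: "'a ^ 'n" and s t :: real
    assume uv: "u \<in> V" "v \<in> V" and st: "0 \<le> s" "0 \<le> t" "s + t = 1"
    show "s *\<^sub>R u + t *\<^sub>R v \<in> V"
      unfolding V_def
    proof (intro CollectI allI)
      fix i
      have "s *\<^sub>R (X i + u $ i) + t *\<^sub>R (X i + v $ i) \<in> \<Omega> i"
        using uv st by (intro convexD[OF conv]) (auto simp: V_def)
      also have "s *\<^sub>R (X i + u $ i) + t *\<^sub>R (X i + v $ i) = (s + t) *\<^sub>R X i + (s *\<^sub>R u + t *\<^sub>R v) $ i"
        by (simp add: algebra_simps)
      finally show "X i + (s *\<^sub>R u + t *\<^sub>R v) $ i \<in> \<Omega> i" using st(3) by simp
    qed
  qed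
  then have "convex (H ` V)" using \<open>linear H\<close> by (intro convex_linear_image)
  moreover have "convex ({0 :: 'a} \<times> {..<0 :: real})" by (intro convex_Times) auto
  moreover have "0 \<in> V" using X(1) by (simp add: V_def)
  moreover have "({0} \<times> {..<0}) \<inter> H ` V = {}"
  proof -
    have "(\<Sum>i\<in>UNIV. ?g i \<bullet> v $ i) \<ge> 0" if v: "v \<in> V" "(\<Sum>i\<in>UNIV. v $ i) = 0" for v
    proof -
      have "feasible \<Omega> d (\<lambda>i. X i + v $ i)" using v X by (auto simp: feasible_def V_def sum.distrib)
      from optimal_first_order[OF diff conv opt this] show ?thesis by simp
    qed
    then show ?thesis by (force simp: H_def)
  qed
  moreover have "{0 :: 'a} \<times> {..<0 :: real} \<noteq> {}" by (auto intro: exI[of _ "-1"])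
  ultimately obtain a b where a: "a \<noteq> 0" "\<forall>x\<in>{0} \<times> {..<0}. a \<bullet> x \<le> b" "\<forall>x\<in>H ` V. a \<bullet> x \<ge> b"
    using separating_hyperplane_sets[of "{0} \<times> {..<0}" "H ` V"] by blast
  obtain p q where pq: "a = (p, q)" by (cases a)
  have T: "q * s \<le> b" if "s < 0" for s
    using a(2) that by (auto simp: pq inner_prod_def)
  have "b \<le> 0" using a(3) \<open>0 \<in> V\<close> by (force simp: H_def pq inner_prod_def)
  then have "q \<ge> 0" using T[of "-1"] by simp
  have "b \<ge> 0"
  proof (rule ccontr)
    assume "\<not> b \<ge> 0"
    \<comment> \<open>The negative number \<open>s = b / (2 * (q + 1))\<close> would satisfy \<open>q * s > b\<close>.\<close>
    then have "0 \<le> b * (q + 2)"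
      using T[of "b / (2 * (q + 1))"] \<open>q \<ge> 0\<close> by (simp add: field_simps)
    moreover have "b * (q + 2) < 0" using \<open>\<not> b \<ge> 0\<close> \<open>q \<ge> 0\<close> by (intro mult_neg_pos) auto
    ultimately show False by simp
  qed
  have S: "0 \<le> p \<bullet> (\<Sum>i\<in>UNIV. v $ i) + q * (\<Sum>i\<in>UNIV. ?g i \<bullet> v $ i)" if "v \<in> V" for v
  proof -
    have "b \<le> a \<bullet> H v" using a(3) that by blast
    then show ?thesis using \<open>b \<ge> 0\<close> by (simp add: H_def pq inner_prod_def)
  qed
  have "q \<noteq> 0"
  proof
    assume "q = 0"
    obtain x where x: "\<And>i. x i \<in> interior (\<Omega> i)" "(\<Sum>i\<in>UNIV. x i) = (\<Sum>i\<in>UNIV. d i)"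
      using slater by (auto simp: slater_def)
    fix i0 :: 'n
    obtain e where e: "e > 0" "cball (x i0) e \<subseteq> \<Omega> i0"
      using x(1)[of i0] by (auto simp: mem_interior_cball)
    \<comment> \<open>A displacement along \<open>p\<close> of length at most \<open>e\<close>.\<close>
    define w where "w = (e / (norm p + 1)) *\<^sub>R p"
    have pos: "norm p + 1 > 0" by (simp add: add_nonneg_pos)
    then have "norm w \<le> e" using e(1) by (simp add: w_def pos_divide_le_eq algebra_simps)
    then have "x i0 - w \<in> \<Omega> i0" using e(2) by (auto simp: dist_norm)
    define v where "v = (\<chi> i. x i - X i - (if i = i0 then w else 0))"
    have "v \<in> V"
      using x(1) interior_subset \<open>x i0 - w \<in> \<Omega> i0\<close> by (auto simp: V_def v_def)
    moreover have "(\<Sum>i\<in>UNIV. v $ i) = - w"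
      using x(2) X(2) by (simp add: v_def sum_subtractf)
    ultimately have "p \<bullet> w \<le> 0" using S[of v] \<open>q = 0\<close> by simp
    then have "(e / (norm p + 1)) * (p \<bullet> p) \<le> 0" by (simp add: w_def)
    moreover have "e / (norm p + 1) > 0" using e(1) pos by simp
    ultimately have "p \<bullet> p \<le> 0" by (meson mult_pos_pos not_le)
    then have "p = 0" by (meson inner_gt_zero_iff not_less)
    then show False using a(1) \<open>q = 0\<close> by (simp add: pq zero_prod_def)
  qed
  then have "q > 0" using \<open>q \<ge> 0\<close> by simp
  show ?thesis
  proof (rule that[of "- (p /\<^sub>R q)"])
    fix i y assume "y \<in> \<Omega> i"
    define v :: "'a ^ 'n" where "v = (\<chi> j. if j = i then y - X i else 0)"
    have "v \<in> V" using \<open>y \<in> \<Omega> i\<close> X(1) by (auto simp: V_def v_def)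
    moreover have "(\<Sum>j\<in>UNIV. v $ j) = y - X i" by (simp add: v_def)
    moreover have "(\<Sum>j\<in>UNIV. ?g j \<bullet> v $ j) = ?g i \<bullet> (y - X i)"
      by (simp add: v_def if_distrib[of "inner _"] cong: if_cong)
    ultimately have "0 \<le> p \<bullet> (y - X i) + q * (?g i \<bullet> (y - X i))" using S[of v] by simp
    moreover have "q * ((- (p /\<^sub>R q) - ?g i) \<bullet> (y - X i)) = - (p \<bullet> (y - X i) + q * (?g i \<bullet> (y - X i)))"
      using \<open>q > 0\<close> by (simp add: inner_diff_left right_diff_distrib)
    ultimately have "q * ((- (p /\<^sub>R q) - ?g i) \<bullet> (y - X i)) \<le> 0" by linarith
    then show "(- (p /\<^sub>R q) - ?g i) \<bullet> (y - X i) \<le> 0" using \<open>q > 0\<close> by (simp only: mult_le_0_iff) auto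
  qed
qed

section \<open>The resource allocation algorithm as a saddle flow\<close>

definition stacked_grad :: "('n::finite \<Rightarrow> 'a::euclidean_space \<Rightarrow> real) \<Rightarrow> 'a ^ 'n \<Rightarrow> 'a ^ 'n" where
  "stacked_grad f x = (\<chi> i. grad (f i) (x $ i))"

definition stacked_constraints :: "('n::finite \<Rightarrow> 'a set) \<Rightarrow> ('a ^ 'n) set" where
  "stacked_constraints \<Omega> = {x. \<forall>i. x $ i \<in> \<Omega> i}"

lemma mem_stacked_constraints: "x \<in> stacked_constraints \<Omega> \<longleftrightarrow> (\<forall>i. x $ i \<in> \<Omega> i)"
  by (simp add: stacked_constraints_def)

lemma norm_vec_power2: "(norm (u :: 'a::real_inner ^ 'n::finite))\<^sup>2 = (\<Sum>i\<in>UNIV. (norm (u $ i))\<^sup>2)"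
  by (simp add: power2_norm_eq_inner inner_vec_def)

lemma inner_vec_nonpos:
  fixes u v :: "'a::real_inner ^ 'n::finite"
  assumes "\<And>i. u $ i \<bullet> v $ i \<le> 0"
  shows "u \<bullet> v \<le> 0"
  unfolding inner_vec_def by (intro sum_nonpos assms)

lemma inner_vec_single:
  fixes u v :: "'a::real_inner ^ 'n::finite"
  assumes "\<And>j. j \<noteq> i \<Longrightarrow> v $ j = 0"
  shows "u \<bullet> v = u $ i \<bullet> v $ i"
proof -
  have "u \<bullet> v = (\<Sum>j\<in>{i}. u $ j \<bullet> v $ j)"
    unfolding inner_vec_def by (rule sum.mono_neutral_right) (auto simp: assms)
  then show ?thesis by simp
qed

lemma norm_vec_le:
  fixes u :: "'a::real_inner ^ 'n::finite" and v :: "'b::real_inner ^ 'n"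
  assumes "\<And>i. norm (u $ i) \<le> c * norm (v $ i)" "c \<ge> 0"
  shows "norm u \<le> c * norm v"
proof (rule power2_le_imp_le)
  have "(norm u)\<^sup>2 \<le> (\<Sum>i\<in>UNIV. (c * norm (v $ i))\<^sup>2)"
    unfolding norm_vec_power2 by (intro sum_mono power_mono assms) auto
  then show "(norm u)\<^sup>2 \<le> (c * norm v)\<^sup>2"
    by (simp add: norm_vec_power2 power_mult_distrib sum_distrib_left)
qed (use assms in simp)

lemma saddle_flow_resource_allocation:
  fixes f :: "'n::finite \<Rightarrow> 'a::euclidean_space \<Rightarrow> real"
  assumes E: "sym E" and strong: "\<And>i. strongly_convex (\<mu> i) (f i)" and cont: "\<And>i. continuous_on UNIV (grad (f i))"
  shows "saddle_flow (stacked_grad f) (laplacian E) (Min (range \<mu>))"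
proof (rule saddle_flow.intro)
  show "linear (laplacian E :: 'a ^ 'n \<Rightarrow> 'a ^ 'n)" by (rule linear_laplacian)
  show "laplacian E u \<bullet> v = u \<bullet> laplacian E v" for u v :: "'a ^ 'n" by (rule laplacian_symmetric[OF E])
  show "0 \<le> u \<bullet> laplacian E u" for u :: "'a ^ 'n" by (rule laplacian_psd[OF E])
  show "0 < Min (range \<mu>)" using strong by (simp add: strongly_convex_def)
  show "continuous_on UNIV (stacked_grad f)"
    unfolding stacked_grad_def
    by (intro continuous_on_vec_lambda continuous_on_compose2[OF cont] continuous_intros) auto
  fix u v :: "'a ^ 'n"
  have "Min (range \<mu>) * (norm (u - v))\<^sup>2 = (\<Sum>i\<in>UNIV. Min (range \<mu>) * (norm (u $ i - v $ i))\<^sup>2)"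
    by (simp add: norm_vec_power2 sum_distrib_left)
  also have "\<dots> \<le> (\<Sum>i\<in>UNIV. (u $ i - v $ i) \<bullet> (grad (f i) (u $ i) - grad (f i) (v $ i)))"
  proof (rule sum_mono)
    fix i
    have "Min (range \<mu>) * (norm (u $ i - v $ i))\<^sup>2 \<le> \<mu> i * (norm (u $ i - v $ i))\<^sup>2"
      by (intro mult_right_mono Min_le) auto
    also have "\<dots> \<le> (u $ i - v $ i) \<bullet> (grad (f i) (u $ i) - grad (f i) (v $ i))"
      using strong by (simp add: strongly_convex_def)
    finally show "Min (range \<mu>) * (norm (u $ i - v $ i))\<^sup>2 \<le> (u $ i - v $ i) \<bullet> (grad (f i) (u $ i) - grad (f i) (v $ i))" .
  qed
  also have "\<dots> = (u - v) \<bullet> (stacked_grad f u - stacked_grad f v)"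
    by (simp add: stacked_grad_def inner_vec_def)
  finally show "Min (range \<mu>) * (norm (u - v))\<^sup>2 \<le> (u - v) \<bullet> (stacked_grad f u - stacked_grad f v)" .
qed

text \<open>
  The componentwise projection inequalities add up to the one for the product set.
\<close>

lemma trajectory_imp_flow:
  fixes f :: "'n::finite \<Rightarrow> real ^ 'm \<Rightarrow> real"
  assumes sf: "saddle_flow (stacked_grad f) (laplacian E) \<mu>"
    and \<Omega>: "\<And>i. closed (\<Omega> i)" "\<And>i. convex (\<Omega> i)"
    and S: "trajectory f \<Omega> d E S"
  shows "saddle_flow.flow (stacked_constraints \<Omega>) (stacked_grad f) (laplacian E) (\<chi> i. d i) S"
proof -
  interpret saddle_flow "stacked_constraints \<Omega>" "stacked_grad f" "laplacian E" "\<chi> i. d i" \<mu>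
    by (rule sf)
  have S: "\<forall>T\<ge>0. abs_continuous_on 0 T S" "\<forall>t\<ge>0. \<forall>i. fst (S t) $ i \<in> \<Omega> i"
    "AE t in lebesgue. t \<ge> 0 \<longrightarrow> (S has_vector_derivative rhs f \<Omega> d E (S t)) (at t within {0..})"
    using S by (auto simp: trajectory_def)
  have step: "\<exists>v. admissible s v \<and> rhs f \<Omega> d E s = velocity s v" if s_in: "\<And>i. fst s $ i \<in> \<Omega> i" for s
  proof -
    obtain x l z where s: "s = (x, l, z)" by (cases s)
    have x: "x $ i \<in> \<Omega> i" for i using s_in[of i] by (simp add: s)
    define w where "w i = - grad (f i) (x $ i) + l $ i" for i
    define v where "v = (\<chi> i. diff_proj (\<Omega> i) (x $ i) (w i))"
    have w: "l - stacked_grad f x = (\<chi> i. w i)" by (simp add: vec_eq_iff w_def stacked_grad_def)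
    have "(l - stacked_grad f x - v) \<bullet> (y - x) \<le> 0" if "y \<in> stacked_constraints \<Omega>" for y
      unfolding w
      by (rule inner_vec_nonpos) (use that \<Omega> x in \<open>simp add: v_def mem_stacked_constraints diff_proj_variational\<close>)
    moreover have "norm v \<le> 1 * norm (l - stacked_grad f x)"
      unfolding w v_def by (rule norm_vec_le) (simp_all add: norm_diff_proj_le \<Omega> x)
    ultimately have "admissible s v" by (simp add: admissible_def s)
    moreover have "rhs f \<Omega> d E s = velocity s v"
      by (simp add: rhs_def velocity_def s v_def w_def laplacian_def vec_eq_iff)
    ultimately show ?thesis by blast
  qed
  have "AE t in lebesgue. t \<ge> 0 \<longrightarrow>
        (\<exists>v. admissible (S t) v \<and> (S has_vector_derivative velocity (S t) v) (at t within {0..}))"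
    using S(3)
  proof eventually_elim
    case (elim t)
    show ?case
    proof
      assume "t \<ge> 0"
      then show "\<exists>v. admissible (S t) v \<and> (S has_vector_derivative velocity (S t) v) (at t within {0..})"
        using step[of "S t"] S(2) elim by metis
    qed
  qed
  then show ?thesis using S(1,2) by (simp add: flow_def mem_stacked_constraints)
qed

text \<open>
  The variational inequality on the product set splits into one per agent by varying a single
  component; each then says that the agent's drive is a normal vector.
\<close>

lemma equil_imp_equilibrium:
  fixes f :: "'n::finite \<Rightarrow> real ^ 'm \<Rightarrow> real"
  assumes sf: "saddle_flow (stacked_grad f) (laplacian E) \<mu>"
    and \<Omega>: "\<And>i. closed (\<Omega> i)" "\<And>i. convex (\<Omega> i)"
    and eq: "saddle_flow.equil (stacked_constraints \<Omega>) (stacked_grad f) (laplacian E) (\<chi> i. d i) S"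
  shows "equilibrium f \<Omega> d E S"
proof -
  interpret saddle_flow "stacked_constraints \<Omega>" "stacked_grad f" "laplacian E" "\<chi> i. d i" \<mu>
    by (rule sf)
  obtain x l z where S: "S = (x, l, z)" by (cases S)
  have "x \<in> stacked_constraints \<Omega>"
    and opt: "\<And>y. y \<in> stacked_constraints \<Omega> \<Longrightarrow> (l - stacked_grad f x) \<bullet> (y - x) \<le> 0"
    and l: "laplacian E l = 0" and z: "laplacian E z = (\<chi> i. d i) - x"
    using eq by (simp_all add: S equil_def)
  then have x: "\<And>i. x $ i \<in> \<Omega> i" by (simp add: mem_stacked_constraints)
  have "diff_proj (\<Omega> i) (x $ i) (- grad (f i) (x $ i) + l $ i) = 0" for i
  proof (rule diff_proj_eq_0[OF \<Omega> x])
    fix y assume "y \<in> \<Omega> i"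
    define Y where "Y = (\<chi> j. if j = i then y else x $ j)"
    have "Y \<in> stacked_constraints \<Omega>"
      using \<open>y \<in> \<Omega> i\<close> x by (simp add: Y_def mem_stacked_constraints)
    then have "(l - stacked_grad f x) \<bullet> (Y - x) \<le> 0" by (rule opt)
    also have "(l - stacked_grad f x) \<bullet> (Y - x) = (l - stacked_grad f x) $ i \<bullet> (Y - x) $ i"
      by (rule inner_vec_single) (simp add: Y_def)
    also have "\<dots> = (- grad (f i) (x $ i) + l $ i) \<bullet> (y - x $ i)"
      by (simp add: Y_def stacked_grad_def)
    finally show "(- grad (f i) (x $ i) + l $ i) \<bullet> (y - x $ i) \<le> 0" .
  qed
  moreover have "(\<Sum>j\<in>nbrs E i. l $ i - l $ j) = 0" for i
    using l by (simp add: laplacian_def vec_eq_iff)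
  moreover have "(\<Sum>j\<in>nbrs E i. z $ i - z $ j) = d i - x $ i" for i
    using z by (simp add: laplacian_def vec_eq_iff)
  ultimately show ?thesis
    using x by (simp add: equilibrium_def S rhs_def vec_eq_iff zero_prod_def)
qed

text \<open>
  The multiplier of the optimal allocation gives \<open>l\<close>; a solution \<open>z\<close> of \<open>L z = d - X\<close> exists because the
  allocation balances the resources.
\<close>

lemma equil_exists:
  fixes f :: "'n::finite \<Rightarrow> real ^ 'm \<Rightarrow> real"
  assumes sf: "saddle_flow (stacked_grad f) (laplacian E) \<mu>"
    and conv: "\<And>i. convex (\<Omega> i)" and diff: "\<And>i x. f i differentiable (at x)"
    and opt: "optimal_solution f \<Omega> d X" and slater: "slater \<Omega> d"
    and E: "sym E" "connected_graph E"
  shows "\<exists>S. saddle_flow.equil (stacked_constraints \<Omega>) (stacked_grad f) (laplacian E) (\<chi> i. d i) S"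
proof -
  interpret saddle_flow "stacked_constraints \<Omega>" "stacked_grad f" "laplacian E" "\<chi> i. d i" \<mu>
    by (rule sf)
  obtain l where l: "\<And>i y. y \<in> \<Omega> i \<Longrightarrow> (l - grad (f i) (X i)) \<bullet> (y - X i) \<le> 0"
    using optimal_common_multiplier[OF diff conv opt slater] by blast
  have X: "\<And>i. X i \<in> \<Omega> i" "(\<Sum>i\<in>UNIV. X i) = (\<Sum>i\<in>UNIV. d i)"
    using opt by (auto simp: optimal_solution_def feasible_def)
  have "(\<Sum>i\<in>UNIV. ((\<chi> i. d i) - (\<chi> i. X i)) $ i) = 0" using X(2) by (simp add: sum_subtractf)
  then obtain z where z: "laplacian E z = (\<chi> i. d i) - (\<chi> i. X i)"
    using laplacian_range[OF E] by blast
  have "((\<chi> i. l) - stacked_grad f (\<chi> i. X i)) \<bullet> (y - (\<chi> i. X i)) \<le> 0"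
    if "y \<in> stacked_constraints \<Omega>" for y
    by (rule inner_vec_nonpos) (use that l in \<open>simp add: stacked_grad_def mem_stacked_constraints\<close>)
  then have "equil (\<chi> i. X i, \<chi> i. l, z)"
    using X(1) z by (simp add: equil_def mem_stacked_constraints laplacian_const)
  then show ?thesis by blast
qed

theorem theorem4p3:
  fixes f :: "'n::finite \<Rightarrow> real ^ 'm \<Rightarrow> real"
    and \<Omega> :: "'n \<Rightarrow> (real ^ 'm) set"
    and d :: "'n \<Rightarrow> real ^ 'm"
    and E :: "('n \<times> 'n) set"
    and \<mu> k :: "'n \<Rightarrow> real"
  assumes closed_convex: "\<And>i. closed (\<Omega> i)" "\<And>i. convex (\<Omega> i)"
    and A1: "\<And>i. cont_differentiable (f i)" "\<And>i. convex_on UNIV (f i)"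
      "\<And>i. local_lipschitz (UNIV :: real set) UNIV (\<lambda>_. grad (f i))"
      "\<And>i x. grad (f i) differentiable (at x)" "\<And>i x. pos_definite (hessian (f i) x)"
    and A2: "\<exists>X. optimal_solution f \<Omega> d X" "slater \<Omega> d"
    and A3: "sym E" "connected_graph E"
    and strong: "\<And>i. strongly_convex (\<mu> i) (f i)"
    and lipschitz: "\<And>i. (k i)-lipschitz_on UNIV (grad (f i))"
  shows "(\<forall>S. trajectory f \<Omega> d E S \<longrightarrow>
            (\<exists>S'. equilibrium f \<Omega> d E S' \<and> (S \<longlongrightarrow> S') at_top)) \<and>
         ((\<forall>i. \<Omega> i = UNIV) \<longrightarrow>
            (\<exists>C>0. \<exists>\<kappa>>0. \<forall>S. trajectory f \<Omega> d E S \<longrightarrow>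
               (\<exists>S'. equilibrium f \<Omega> d E S' \<and> (S \<longlongrightarrow> S') at_top \<and>
                  (\<forall>t\<ge>0. norm (S t - S') \<le> C * norm (S 0 - S') * exp (- \<kappa> * t)))))"
proof -
  have diff: "\<And>i x. f i differentiable (at x)" and cont: "\<And>i. continuous_on UNIV (grad (f i))"
    using A1(1) by (simp_all add: cont_differentiable_def)
  have sf: "saddle_flow (stacked_grad f) (laplacian E) (Min (range \<mu>))"
    by (rule saddle_flow_resource_allocation[OF A3(1) strong cont])
  interpret saddle_flow "stacked_constraints \<Omega>" "stacked_grad f" "laplacian E" "\<chi> i. d i" "Min (range \<mu>)"
    by (rule sf)
  note flow = trajectory_imp_flow[where \<Omega> = \<Omega> and d = d, OF sf closed_convex]
  note equilibrium = equil_imp_equilibrium[where \<Omega> = \<Omega> and d = d, OF sf closed_convex]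
  obtain X where "optimal_solution f \<Omega> d X" using A2(1) by blast
  from equil_exists[OF sf closed_convex(2) diff this A2(2) A3] obtain S0 where S0: "equil S0" by blast
  show ?thesis
  proof (intro conjI impI allI)
    fix S assume "trajectory f \<Omega> d E S"
    then show "\<exists>S'. equilibrium f \<Omega> d E S' \<and> (S \<longlongrightarrow> S') at_top"
      using flow_converges[OF flow S0] equilibrium by blast
  next
    assume "\<forall>i. \<Omega> i = UNIV"
    then have K: "stacked_constraints \<Omega> = UNIV" by (simp add: stacked_constraints_def)
    have lip: "norm (stacked_grad f u - stacked_grad f v) \<le> Max (range k) * norm (u - v)" for u v
    proof (rule norm_vec_le)
      fix i
      have "norm (grad (f i) (u $ i) - grad (f i) (v $ i)) \<le> k i * norm (u $ i - v $ i)"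
        using lipschitz_onD[OF lipschitz] by (simp add: dist_norm)
      also have "\<dots> \<le> Max (range k) * norm (u $ i - v $ i)" by (intro mult_right_mono Max_ge) auto
      finally show "norm ((stacked_grad f u - stacked_grad f v) $ i) \<le> Max (range k) * norm ((u - v) $ i)"
        by (simp add: stacked_grad_def)
    next
      fix i
      have "0 \<le> k i" by (rule lipschitz_on_nonneg[OF lipschitz])
      also have "\<dots> \<le> Max (range k)" by (intro Max_ge) auto
      finally show "0 \<le> Max (range k)" .
    qed
    obtain C \<kappa> where "C > 0" "\<kappa> > 0" and decay: "\<And>S. flow S \<Longrightarrow> \<exists>S'. equil S' \<and> (S \<longlongrightarrow> S') at_top \<and>
        (\<forall>t\<ge>0. norm (S t - S') \<le> C * norm (S 0 - S') * exp (- \<kappa> * t))"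
      using flow_converges_exponentially[OF K lip S0] by blast
    show "\<exists>C>0. \<exists>\<kappa>>0. \<forall>S. trajectory f \<Omega> d E S \<longrightarrow>
               (\<exists>S'. equilibrium f \<Omega> d E S' \<and> (S \<longlongrightarrow> S') at_top \<and>
                  (\<forall>t\<ge>0. norm (S t - S') \<le> C * norm (S 0 - S') * exp (- \<kappa> * t)))"
    proof (rule exI[of _ C], intro conjI, fact, rule exI[of _ \<kappa>], intro conjI allI impI, fact)
      fix S assume "trajectory f \<Omega> d E S"
      from decay[OF flow[OF this]]
      show "\<exists>S'. equilibrium f \<Omega> d E S' \<and> (S \<longlongrightarrow> S') at_top \<and>
                  (\<forall>t\<ge>0. norm (S t - S') \<le> C * norm (S 0 - S') * exp (- \<kappa> * t))"
        using equilibrium by blast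
    qed
  qed
qed

end
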